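(* Let $R$ be a commutative ring and let $C$ and $D$ be dgmodules over $R$ satisfying assumption (A). a) Given $g\in\mathrm{Hom}_i(H(C),H(D))$, there exists $f\in\mathrm{Hom}_i(C,D)$ such that $\partial f=0$ and $\bar f=g$. b) For $f\in\mathrm{Hom}_i(C,D)$ satisfying $\partial f=0$ and $\bar f=0\in\mathrm{Hom}_i(H(C),H(D))$, there exists $u\in\mathrm{Hom}_{i+1}(C,D)$ such that $\partial u=f$. Consequently the map $\mathcal{H}_{C,D}:H(\mathrm{Hom}(C,D))\to\mathrm{Hom}(H(C),H(D))$ is an isomorphism of graded $R$-modules, and the dgmodule $\mathrm{Hom}(C,D)$ satisfies assumption (A).
   Context: A dgmodule over the commutative ring $R$ is a $\mathbb{Z}$-graded $R$-module $C=(C_i)_{i\in\mathbb{Z}}$ with an $R$-linear differential $\partial_C$ of degree $-1$, $\partial_C^2=0$. Put $Z_i(C)=\ker(\partial_C:C_i\to C_{i-1})$, $B_i(C)=\mathrm{im}(\partial_C:C_{i+1}\to C_i)$, $H_i(C)=Z_i(C)/B_i(C)$. $\mathrm{Hom}(C,D)$ is the dgmodule with $\mathrm{Hom}_i(C,D)=\prod_{n\in\mathbb{Z}}\mathrm{Hom}_R(C_n,D_{n+i})$ and differential $(\partial f)_n(c)=\partial_D(f_n(c))-(-1)^i f_{n-1}(\partial_C c)$ for $f\in\mathrm{Hom}_i(C,D)$, $c\in C_n$. For graded modules (such as $H(C),H(D)$) the same definition is used with zero differentials. If $f\in\mathrm{Hom}_i(C,D)$ and $\partial f=0$, then $f$ induces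 $\bar f\in\mathrm{Hom}_i(H(C),H(D))$, $\bar f([c])=[f(c)]$; if $f=\partial u$ then $\bar f=0$. Hence there is a well-defined map $\mathcal{H}_{C,D}:H(\mathrm{Hom}(C,D))\to\mathrm{Hom}(H(C),H(D))$, $[f]\mapsto\bar f$. Assumption (A) for a dgmodule $C$: the sequences of graded $R$-modules $0\to Z(C)\to C\xrightarrow{\partial_C}B(C)\to 0$ (where $\partial_C$ maps $C_n$ onto $B_{n-1}(C)$) and $0\to B(C)\to Z(C)\to H(C)\to 0$ are split exact. *)

theory Defs
  imports "HOL-Algebra.AbelCoset" "HOL-Algebra.Module"
begin

section \<open>Modules over a commutative ring\<close>

definition mod_hom :: "('a, 'r) ring_scheme \<Rightarrow> ('a, 'b) module \<Rightarrow> ('a, 'c) module \<Rightarrow> ('b \<Rightarrow> 'c) set"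
  where "mod_hom R M N =
    {f \<in> carrier M \<rightarrow> carrier N.
       (\<forall>x \<in> carrier M. \<forall>y \<in> carrier M. f (x \<oplus>\<^bsub>M\<^esub> y) = f x \<oplus>\<^bsub>N\<^esub> f y) \<and>
       (\<forall>a \<in> carrier R. \<forall>x \<in> carrier M. f (a \<odot>\<^bsub>M\<^esub> x) = a \<odot>\<^bsub>N\<^esub> f x)}"

definition mod_iso :: "('a, 'r) ring_scheme \<Rightarrow> ('a, 'b) module \<Rightarrow> ('a, 'c) module \<Rightarrow> ('b \<Rightarrow> 'c) set"
  where "mod_iso R M N = {f \<in> mod_hom R M N. bij_betw f (carrier M) (carrier N)}"

text \<open>The fields \<open>mult\<close> and \<open>one\<close>, which the record type \<open>module\<close> inherits from \<open>ring\<close>,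
  play no role for modules and are left unspecified.\<close>

definition quot_mod :: "('a, 'b) module \<Rightarrow> 'b set \<Rightarrow> ('a, 'b set) module"
  where "quot_mod M N =
    \<lparr>carrier = a_rcosets\<^bsub>M\<^esub> N, mult = undefined, one = undefined, zero = N, add = set_add M,
     smult = (\<lambda>a X. \<Union>x \<in> X. N +>\<^bsub>M\<^esub> (a \<odot>\<^bsub>M\<^esub> x))\<rparr>"

text \<open>Split exactness of \<open>0 \<rightarrow> A \<rightarrow> B \<rightarrow> C \<rightarrow> 0\<close>, with maps \<open>f\<close> and \<open>g\<close>.\<close>

definition split_exact ::
  "('a, 'r) ring_scheme \<Rightarrow> ('a, 'b) module \<Rightarrow> ('b \<Rightarrow> 'c) \<Rightarrow> ('a, 'c) module \<Rightarrow> ('c \<Rightarrow> 'd) \<Rightarrow>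
   ('a, 'd) module \<Rightarrow> bool"
  where "split_exact R A f B g C \<longleftrightarrow>
    f \<in> mod_hom R A B \<and> g \<in> mod_hom R B C \<and>
    inj_on f (carrier A) \<and> f ` carrier A = a_kernel B C g \<and> g ` carrier B = carrier C \<and>
    (\<exists>s \<in> mod_hom R C B. \<forall>c \<in> carrier C. g (s c) = c)"


section \<open>Dgmodules\<close>

text \<open>Graded modules are families \<open>int \<Rightarrow> ('a, 'c) module\<close>; the carriers in different degrees
  share a type but need not be related.\<close>

record ('a, 'c) dgm =
  grade :: "int \<Rightarrow> ('a, 'c) module"
  bd :: "int \<Rightarrow> 'c \<Rightarrow> 'c"

locale dgmodule = cring R for R :: "('a, 'r) ring_scheme" (structure) +
  fixes C :: "('a, 'c) dgm"
  assumes grade_module: "module R (grade C n)"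
    and bd_hom: "bd C n \<in> mod_hom R (grade C n) (grade C (n - 1))"
    and bd_bd: "c \<in> carrier (grade C n) \<Longrightarrow> bd C (n - 1) (bd C n c) = \<zero>\<^bsub>grade C (n - 1 - 1)\<^esub>"

definition cycles :: "('a, 'c) dgm \<Rightarrow> int \<Rightarrow> ('a, 'c) module"
  where "cycles C n = (grade C n)\<lparr>carrier := a_kernel (grade C n) (grade C (n - 1)) (bd C n)\<rparr>"

definition boundaries :: "('a, 'c) dgm \<Rightarrow> int \<Rightarrow> ('a, 'c) module"
  where "boundaries C n = (grade C n)\<lparr>carrier := bd C (n + 1) ` carrier (grade C (n + 1))\<rparr>"

definition homology :: "('a, 'c) dgm \<Rightarrow> int \<Rightarrow> ('a, 'c set) module"
  where "homology C n = quot_mod (cycles C n) (carrier (boundaries C n))"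

definition hclass :: "('a, 'c) dgm \<Rightarrow> int \<Rightarrow> 'c \<Rightarrow> 'c set"
  where "hclass C n z = carrier (boundaries C n) +>\<^bsub>cycles C n\<^esub> z"

definition zero_bd :: "(int \<Rightarrow> ('a, 'c) module) \<Rightarrow> ('a, 'c) dgm"
  where "zero_bd M = \<lparr>grade = M, bd = (\<lambda>n _. \<zero>\<^bsub>M (n - 1)\<^esub>)\<rparr>"

text \<open>A splitting of a sequence of graded modules is a family of splittings, one in each degree.\<close>

definition assumption_A :: "('a, 'r) ring_scheme \<Rightarrow> ('a, 'c) dgm \<Rightarrow> bool"
  where "assumption_A R C \<longleftrightarrow>
    (\<forall>n. split_exact R (cycles C n) (\<lambda>z. z) (grade C n) (bd C n) (boundaries C (n - 1))) \<and>
    (\<forall>n. split_exact R (boundaries C n) (\<lambda>b. b) (cycles C n) (hclass C n) (homology C n))"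


section \<open>The dgmodule of homomorphisms\<close>

text \<open>A homomorphism between components is represented by its unique extensional
  representative, so that equality in \<open>Hom\<^sub>i(C, D)\<close> is equality of families of functions.\<close>

definition Hom_grade ::
  "('a, 'r) ring_scheme \<Rightarrow> ('a, 'c) dgm \<Rightarrow> ('a, 'd) dgm \<Rightarrow> int \<Rightarrow> ('a, int \<Rightarrow> 'c \<Rightarrow> 'd) module"
  where "Hom_grade R C D i =
    \<lparr>carrier = {f. \<forall>n. f n \<in> mod_hom R (grade C n) (grade D (n + i)) \<inter> extensional (carrier (grade C n))},
     mult = undefined, one = undefined,
     zero = (\<lambda>n. \<lambda>c \<in> carrier (grade C n). \<zero>\<^bsub>grade D (n + i)\<^esub>),
     add = (\<lambda>f g n. \<lambda>c \<in> carrier (grade C n). f n c \<oplus>\<^bsub>grade D (n + i)\<^esub> g n c),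
     smult = (\<lambda>a f n. \<lambda>c \<in> carrier (grade C n). a \<odot>\<^bsub>grade D (n + i)\<^esub> f n c)\<rparr>"

definition signed :: "('a, 'c) module \<Rightarrow> int \<Rightarrow> 'c \<Rightarrow> 'c"
  where "signed M i x = (if even i then x else \<ominus>\<^bsub>M\<^esub> x)"

definition Hom_bd ::
  "('a, 'c) dgm \<Rightarrow> ('a, 'd) dgm \<Rightarrow> int \<Rightarrow> (int \<Rightarrow> 'c \<Rightarrow> 'd) \<Rightarrow> (int \<Rightarrow> 'c \<Rightarrow> 'd)"
  where "Hom_bd C D i f = (\<lambda>n. \<lambda>c \<in> carrier (grade C n).
    bd D (n + i) (f n c) \<ominus>\<^bsub>grade D (n + i - 1)\<^esub>
    signed (grade D (n + i - 1)) i (f (n - 1) (bd C n c)))"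

definition Hom_dg ::
  "('a, 'r) ring_scheme \<Rightarrow> ('a, 'c) dgm \<Rightarrow> ('a, 'd) dgm \<Rightarrow> ('a, int \<Rightarrow> 'c \<Rightarrow> 'd) dgm"
  where "Hom_dg R C D = \<lparr>grade = Hom_grade R C D, bd = Hom_bd C D\<rparr>"

text \<open>The maps \<open>[c] \<mapsto> [f c]\<close> and \<open>[f] \<mapsto> induced f\<close> are defined by their common value on all
  representatives of a class; lemmas \<open>induced_hclass\<close> and \<open>hom_homology_hclass\<close> below show that
  this value exists.\<close>

definition induced ::
  "('a, 'c) dgm \<Rightarrow> ('a, 'd) dgm \<Rightarrow> int \<Rightarrow> (int \<Rightarrow> 'c \<Rightarrow> 'd) \<Rightarrow> (int \<Rightarrow> 'c set \<Rightarrow> 'd set)"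
  where "induced C D i f = (\<lambda>n. \<lambda>X \<in> carrier (homology C n).
    the_elem ((\<lambda>c. hclass D (n + i) (f n c)) ` X))"

definition hom_homology ::
  "('a, 'c) dgm \<Rightarrow> ('a, 'd) dgm \<Rightarrow> int \<Rightarrow> (int \<Rightarrow> 'c \<Rightarrow> 'd) set \<Rightarrow> (int \<Rightarrow> 'c set \<Rightarrow> 'd set)"
  where "hom_homology C D i F = the_elem (induced C D i ` F)"

lemma mod_homD:
  assumes "f \<in> mod_hom R M N"
  shows "x \<in> carrier M \<Longrightarrow> f x \<in> carrier N"
    and "x \<in> carrier M \<Longrightarrow> y \<in> carrier M \<Longrightarrow> f (x \<oplus>\<^bsub>M\<^esub> y) = f x \<oplus>\<^bsub>N\<^esub> f y"
    and "a \<in> carrier R \<Longrightarrow> x \<in> carrier M \<Longrightarrow> f (a \<odot>\<^bsub>M\<^esub> x) = a \<odot>\<^bsub>N\<^esub> f x"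
  using assms by (auto simp: mod_hom_def)

lemma mod_hom_zero:
  assumes "module R M" "module R N" "f \<in> mod_hom R M N"
  shows "f \<zero>\<^bsub>M\<^esub> = \<zero>\<^bsub>N\<^esub>"
proof -
  interpret M: module R M by fact
  interpret N: module R N by fact
  have "f (\<zero>\<^bsub>R\<^esub> \<odot>\<^bsub>M\<^esub> \<zero>\<^bsub>M\<^esub>) = \<zero>\<^bsub>R\<^esub> \<odot>\<^bsub>N\<^esub> f \<zero>\<^bsub>M\<^esub>"
    by (rule mod_homD(3)[OF assms(3)]) auto
  then show ?thesis
    using mod_homD(1)[OF assms(3)] by simp
qed

lemma mod_hom_neg:
  assumes "module R M" "module R N" "f \<in> mod_hom R M N" "x \<in> carrier M"
  shows "f (\<ominus>\<^bsub>M\<^esub> x) = \<ominus>\<^bsub>N\<^esub> f x"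
proof -
  interpret M: module R M by fact
  interpret N: module R N by fact
  have "f (\<ominus>\<^bsub>M\<^esub> x) \<oplus>\<^bsub>N\<^esub> f x = \<zero>\<^bsub>N\<^esub>"
    using mod_homD(2)[OF assms(3), of "\<ominus>\<^bsub>M\<^esub> x" x] assms mod_hom_zero[OF assms(1-3)]
    by (simp add: M.M.l_neg)
  then show ?thesis
    using mod_homD(1)[OF assms(3)] assms(4) N.M.minus_equality by simp
qed

lemma carrier_cycles:
  "z \<in> carrier (cycles C n) \<longleftrightarrow> z \<in> carrier (grade C n) \<and> bd C n z = \<zero>\<^bsub>grade C (n - 1)\<^esub>"
  by (auto simp: cycles_def a_kernel_def kernel_def)

lemma carrier_homology:
  "carrier (homology C n) = hclass C n ` carrier (cycles C n)"
  by (auto simp: homology_def quot_mod_def hclass_def A_RCOSETS_def RCOSETS_def a_r_coset_def)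

lemma hclass_eq:
  "hclass C n z = {bd C (n + 1) c \<oplus>\<^bsub>grade C n\<^esub> z | c. c \<in> carrier (grade C (n + 1))}"
  by (auto simp: hclass_def boundaries_def cycles_def a_r_coset_def r_coset_def)

context dgmodule
begin

lemma bd_up:
  assumes "c \<in> carrier (grade C (n + 1))"
  shows "bd C (n + 1) c \<in> carrier (grade C n)"
    and "bd C n (bd C (n + 1) c) = \<zero>\<^bsub>grade C (n - 1)\<^esub>"
  using mod_homD(1)[OF bd_hom assms] bd_bd[OF assms] by simp_all

lemma self_in_hclass:
  assumes "z \<in> carrier (grade C n)"
  shows "z \<in> hclass C n z"
proof -
  interpret M: module R "grade C n" by (rule grade_module)
  interpret N: module R "grade C (n + 1)" by (rule grade_module)
  have "bd C (n + 1) \<zero>\<^bsub>grade C (n + 1)\<^esub> = \<zero>\<^bsub>grade C n\<^esub>"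
    using mod_hom_zero[OF grade_module grade_module bd_hom, of "n + 1"] by simp
  then show ?thesis
    using assms by (auto simp: hclass_eq intro!: exI[of _ "\<zero>\<^bsub>grade C (n + 1)\<^esub>"])
qed

lemma hclass_subset_cycles:
  assumes "z \<in> carrier (cycles C n)" "x \<in> hclass C n z"
  shows "x \<in> carrier (cycles C n)"
proof -
  interpret M: module R "grade C n" by (rule grade_module)
  interpret N: module R "grade C (n - 1)" by (rule grade_module)
  show ?thesis
    using assms mod_homD(2)[OF bd_hom[of n]] bd_up
    by (auto simp: hclass_eq carrier_cycles)
qed

lemma hclass_absorb:
  assumes c: "c \<in> carrier (grade C (n + 1))" and z: "z \<in> carrier (grade C n)"
  shows "hclass C n (bd C (n + 1) c \<oplus>\<^bsub>grade C n\<^esub> z) = hclass C n z"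
proof -
  interpret M: module R "grade C n" by (rule grade_module)
  interpret N: module R "grade C (n + 1)" by (rule grade_module)
  have hom: "bd C (n + 1) \<in> mod_hom R (grade C (n + 1)) (grade C n)"
    using bd_hom[of "n + 1"] by simp
  have 1: "bd C (n + 1) c' \<oplus>\<^bsub>grade C n\<^esub> (bd C (n + 1) c \<oplus>\<^bsub>grade C n\<^esub> z) =
      bd C (n + 1) (c' \<oplus>\<^bsub>grade C (n + 1)\<^esub> c) \<oplus>\<^bsub>grade C n\<^esub> z"
    if "c' \<in> carrier (grade C (n + 1))" for c'
    using that c z mod_homD(2)[OF hom that c] bd_up(1)[OF that] bd_up(1)[OF c]
    by (simp add: M.M.a_assoc)
  have 2: "bd C (n + 1) c' \<oplus>\<^bsub>grade C n\<^esub> z =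
      bd C (n + 1) (c' \<ominus>\<^bsub>grade C (n + 1)\<^esub> c) \<oplus>\<^bsub>grade C n\<^esub> (bd C (n + 1) c \<oplus>\<^bsub>grade C n\<^esub> z)"
    if "c' \<in> carrier (grade C (n + 1))" for c'
  proof -
    have "(c' \<ominus>\<^bsub>grade C (n + 1)\<^esub> c) \<oplus>\<^bsub>grade C (n + 1)\<^esub> c = c'"
      using that c by (simp add: N.M.minus_eq N.M.a_assoc N.M.l_neg)
    then show ?thesis
      using 1[of "c' \<ominus>\<^bsub>grade C (n + 1)\<^esub> c"] that c by simp
  qed
  show ?thesis
  proof (intro equalityI subsetI)
    fix x assume "x \<in> hclass C n (bd C (n + 1) c \<oplus>\<^bsub>grade C n\<^esub> z)"
    then obtain c' where c': "c' \<in> carrier (grade C (n + 1))"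
      and x: "x = bd C (n + 1) c' \<oplus>\<^bsub>grade C n\<^esub> (bd C (n + 1) c \<oplus>\<^bsub>grade C n\<^esub> z)"
      by (auto simp: hclass_eq)
    have "c' \<oplus>\<^bsub>grade C (n + 1)\<^esub> c \<in> carrier (grade C (n + 1))"
      using c c' by simp
    then show "x \<in> hclass C n z"
      unfolding hclass_eq x 1[OF c'] by blast
  next
    fix x assume "x \<in> hclass C n z"
    then obtain c' where c': "c' \<in> carrier (grade C (n + 1))"
      and x: "x = bd C (n + 1) c' \<oplus>\<^bsub>grade C n\<^esub> z"
      by (auto simp: hclass_eq)
    have "c' \<ominus>\<^bsub>grade C (n + 1)\<^esub> c \<in> carrier (grade C (n + 1))"
      using c c' by simp
    then show "x \<in> hclass C n (bd C (n + 1) c \<oplus>\<^bsub>grade C n\<^esub> z)"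
      unfolding hclass_eq x 2[OF c'] by blast
  qed
qed

end

lemma the_elem_image_eq:
  assumes "x \<in> X" "\<And>y. y \<in> X \<Longrightarrow> h y = h x"
  shows "the_elem (h ` X) = h x"
proof -
  have "h ` X = {h x}" using assms by blast
  then show ?thesis by simp
qed

lemma Hom_cycle_commutes:
  assumes C: "dgmodule R C" and D: "dgmodule R D"
    and f: "f \<in> carrier (cycles (Hom_dg R C D) i)" and c: "c \<in> carrier (grade C n)"
  shows "bd D (n + i) (f n c) = signed (grade D (n + i - 1)) i (f (n - 1) (bd C n c))"
proof -
  interpret C: dgmodule R C by fact
  interpret D: dgmodule R D by fact
  interpret M: module R "grade D (n + i - 1)" by (rule D.grade_module)
  have h: "f m \<in> mod_hom R (grade C m) (grade D (m + i))" for m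
    using f by (auto simp: carrier_cycles Hom_dg_def Hom_grade_def)
  have "Hom_bd C D i f n c = \<zero>\<^bsub>grade D (n + i - 1)\<^esub>"
    using f c by (auto simp: carrier_cycles Hom_dg_def Hom_grade_def add_diff_eq)
  then have eq: "bd D (n + i) (f n c) \<ominus>\<^bsub>grade D (n + i - 1)\<^esub>
      signed (grade D (n + i - 1)) i (f (n - 1) (bd C n c)) = \<zero>\<^bsub>grade D (n + i - 1)\<^esub>"
    using c by (simp add: Hom_bd_def)
  have idx: "n - 1 + i = n + i - 1" by simp
  have "f (n - 1) (bd C n c) \<in> carrier (grade D (n + i - 1))"
    using mod_homD(1)[OF h[of "n - 1"] mod_homD(1)[OF C.bd_hom c]] by (simp only: idx)
  then have "signed (grade D (n + i - 1)) i (f (n - 1) (bd C n c)) \<in> carrier (grade D (n + i - 1))"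
    by (simp add: signed_def)
  moreover have "bd D (n + i) (f n c) \<in> carrier (grade D (n + i - 1))"
    using mod_homD(1)[OF D.bd_hom mod_homD(1)[OF h c]] .
  ultimately show ?thesis
    using eq M.M.minus_equality[of "bd D (n + i) (f n c)"
        "\<ominus>\<^bsub>grade D (n + i - 1)\<^esub> signed (grade D (n + i - 1)) i (f (n - 1) (bd C n c))"]
    by (simp add: M.M.minus_eq)
qed

lemma induced_hclass:
  assumes C: "dgmodule R C" and D: "dgmodule R D"
    and f: "f \<in> carrier (cycles (Hom_dg R C D) i)" and z: "z \<in> carrier (cycles C n)"
  shows "induced C D i f n (hclass C n z) = hclass D (n + i) (f n z)"
proof -
  interpret C: dgmodule R C by fact
  interpret D: dgmodule R D by fact
  have h: "f m \<in> mod_hom R (grade C m) (grade D (m + i))" for m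
    using f by (auto simp: carrier_cycles Hom_dg_def Hom_grade_def)
  have zc: "z \<in> carrier (grade C n)" using z by (simp add: carrier_cycles)
  have "hclass D (n + i) (f n x) = hclass D (n + i) (f n z)" if x: "x \<in> hclass C n z" for x
  proof -
    interpret M: module R "grade D (n + i)" by (rule D.grade_module)
    interpret N: module R "grade D (n + i + 1)" by (rule D.grade_module)
    obtain c where c: "c \<in> carrier (grade C (n + 1))" and xc: "x = bd C (n + 1) c \<oplus>\<^bsub>grade C n\<^esub> z"
      using x by (auto simp: hclass_eq)
    have fb: "f n (bd C (n + 1) c) \<in> carrier (grade D (n + i))"
      using mod_homD(1)[OF h] C.bd_up(1)[OF c] by auto
    have idx: "n + 1 + i = n + i + 1" by simp
    define d where "d = signed (grade D (n + i + 1)) i (f (n + 1) c)"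
    have fc: "f (n + 1) c \<in> carrier (grade D (n + i + 1))"
      using mod_homD(1)[OF h c] by (simp only: idx)
    then have d: "d \<in> carrier (grade D (n + i + 1))" by (simp add: d_def signed_def)
    have com: "bd D (n + i + 1) (f (n + 1) c) = signed (grade D (n + i)) i (f n (bd C (n + 1) c))"
      using Hom_cycle_commutes[OF C D f c] by (simp add: idx)
    have bdh: "bd D (n + i + 1) \<in> mod_hom R (grade D (n + i + 1)) (grade D (n + i))"
      using D.bd_hom[of "n + i + 1"] by simp
    have "bd D (n + i + 1) d = f n (bd C (n + 1) c)"
      using com mod_hom_neg[OF D.grade_module D.grade_module bdh fc] fb
      by (auto simp: d_def signed_def)
    then have "f n x = bd D (n + i + 1) d \<oplus>\<^bsub>grade D (n + i)\<^esub> f n z"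
      using mod_homD(2)[OF h C.bd_up(1)[OF c] zc] xc by simp
    then show ?thesis
      using D.hclass_absorb[OF d mod_homD(1)[OF h zc]] by simp
  qed
  then have "the_elem ((\<lambda>c. hclass D (n + i) (f n c)) ` hclass C n z) = hclass D (n + i) (f n z)"
    by (rule the_elem_image_eq[where h = "\<lambda>c. hclass D (n + i) (f n c)",
          OF C.self_in_hclass[OF zc]])
  then show ?thesis
    using z by (simp add: induced_def carrier_homology)
qed

lemma hom_homology_hclass:
  assumes C: "dgmodule R C" and D: "dgmodule R D"
    and f: "f \<in> carrier (cycles (Hom_dg R C D) i)"
  shows "hom_homology C D i (hclass (Hom_dg R C D) i f) = induced C D i f"
proof -
  interpret C: dgmodule R C by fact
  interpret D: dgmodule R D by fact
  have h: "f m \<in> mod_hom R (grade C m) (grade D (m + i))" for m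
    using f by (auto simp: carrier_cycles Hom_dg_def Hom_grade_def)
  have same: "induced C D i g = induced C D i f" if g: "g \<in> hclass (Hom_dg R C D) i f" for g
  proof -
    obtain u where u: "u \<in> carrier (Hom_grade R C D (i + 1))"
      and gu: "g = Hom_bd C D (i + 1) u \<oplus>\<^bsub>Hom_grade R C D i\<^esub> f"
      using g by (auto simp: hclass_eq Hom_dg_def)
    have hu: "u m \<in> mod_hom R (grade C m) (grade D (m + (i + 1)))" for m
      using u by (auto simp: Hom_grade_def)
    have "hclass D (n + i) (g n x) = hclass D (n + i) (f n x)" if x: "x \<in> carrier (cycles C n)" for n x
    proof -
      interpret M: module R "grade D (n + i)" by (rule D.grade_module)
      have xc: "x \<in> carrier (grade C n)" and x0: "bd C n x = \<zero>\<^bsub>grade C (n - 1)\<^esub>"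
        using x by (auto simp: carrier_cycles)
      have idx: "n - 1 + (i + 1) = n + i" "n + (i + 1) - 1 = n + i" "n + (i + 1) = n + i + 1"
        by simp_all
      have "u (n - 1) (bd C n x) = \<zero>\<^bsub>grade D (n + i)\<^esub>"
        using mod_hom_zero[OF C.grade_module D.grade_module hu[of "n - 1"]] x0 by (simp only: idx)
      moreover have ux: "u n x \<in> carrier (grade D (n + i + 1))"
        using mod_homD(1)[OF hu xc] by (simp only: idx)
      ultimately have "Hom_bd C D (i + 1) u n x = bd D (n + i + 1) (u n x)"
        using xc D.bd_up(1)[OF ux] unfolding Hom_bd_def idx
        by (auto simp: signed_def M.M.minus_eq)
      then have "g n x = bd D (n + i + 1) (u n x) \<oplus>\<^bsub>grade D (n + i)\<^esub> f n x"
        using xc by (simp add: gu Hom_grade_def)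
      then show ?thesis
        using D.hclass_absorb[OF ux mod_homD(1)[OF h xc]] by simp
    qed
    then have "(\<lambda>x. hclass D (n + i) (g n x)) ` X = (\<lambda>x. hclass D (n + i) (f n x)) ` X"
      if "X \<in> carrier (homology C n)" for n X
      using that C.hclass_subset_cycles by (intro image_cong) (auto simp: carrier_homology)
    then show ?thesis
      unfolding induced_def by (intro ext) (simp add: restrict_def)
  qed
  have "f \<in> hclass (Hom_dg R C D) i f"
  proof -
    let ?u = "\<zero>\<^bsub>Hom_grade R C D (i + 1)\<^esub>"
    have mD: "module R (grade D m)" for m by (rule D.grade_module)
    have idx: "n + (i + 1) - 1 = n + i" "n - 1 + (i + 1) = n + i" for n by simp_all
    have u: "?u \<in> carrier (Hom_grade R C D (i + 1))"
    proof -
      have "(\<lambda>c \<in> carrier (grade C n). \<zero>\<^bsub>grade D (n + (i + 1))\<^esub>) \<in>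
          mod_hom R (grade C n) (grade D (n + (i + 1)))" for n
      proof -
        interpret M: module R "grade D (n + (i + 1))" by (rule mD)
        interpret N: module R "grade C n" by (rule C.grade_module)
        show ?thesis by (auto simp: mod_hom_def)
      qed
      then show ?thesis by (simp add: Hom_grade_def)
    qed
    have "(Hom_bd C D (i + 1) ?u \<oplus>\<^bsub>Hom_grade R C D i\<^esub> f) n x = f n x" for n x
    proof (cases "x \<in> carrier (grade C n)")
      case True
      interpret M: module R "grade D (n + i)" by (rule mD)
      have "bd D (n + (i + 1)) \<zero>\<^bsub>grade D (n + (i + 1))\<^esub> = \<zero>\<^bsub>grade D (n + i)\<^esub>"
        using mod_hom_zero[OF mD mD D.bd_hom[of "n + (i + 1)"]] by (simp only: idx)
      then have "Hom_bd C D (i + 1) ?u n x = \<zero>\<^bsub>grade D (n + i)\<^esub>"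
        using True mod_homD(1)[OF C.bd_hom True] unfolding Hom_bd_def idx
        by (auto simp: Hom_grade_def signed_def idx M.M.minus_eq)
      then show ?thesis
        using True mod_homD(1)[OF h True] by (simp add: Hom_grade_def)
    next
      case False
      have "f n \<in> extensional (carrier (grade C n))"
        using f by (auto simp: carrier_cycles Hom_dg_def Hom_grade_def)
      with False show ?thesis by (simp add: Hom_grade_def extensional_def)
    qed
    then have "Hom_bd C D (i + 1) ?u \<oplus>\<^bsub>Hom_grade R C D i\<^esub> f = f" by (intro ext)
    from this[symmetric] u show ?thesis
      unfolding hclass_eq Hom_dg_def dgm.simps by blast
  qed
  then show ?thesis
    unfolding hom_homology_def
    by (rule the_elem_image_eq[where h = "induced C D i"]) (rule same)
qed

end

theory Submission
  imports Defs
begin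

text \<open>Write \<open>\<partial>\<close> for every differential. The two splittings in assumption (A) are equivalent to a
  single piece of data on \<open>C\<close> itself: a linear map \<open>h\<close> of degree \<open>1\<close> with \<open>\<partial> h \<partial> = \<partial>\<close>. Indeed, such an
  \<open>h\<close> splits \<open>\<partial> : C \<rightarrow> B(C)\<close>, and \<open>[z] \<mapsto> z - \<partial> h z\<close> splits \<open>Z(C) \<rightarrow> H(C)\<close>; conversely \<open>h\<close> is the
  projection \<open>C \<rightarrow> Z(C) \<rightarrow> B(C)\<close> given by the two splittings, followed by the section
  \<open>B(C) \<rightarrow> C\<close> (lemmas \<open>split_imp_assumption_A\<close> and \<open>assumption_A_obtains_split\<close>).

  Put \<open>e = 1 - \<partial> h - h \<partial>\<close>. Then \<open>\<partial> e = 0\<close> and \<open>e \<partial> = 0\<close>, and \<open>[e z] = [z]\<close> for every cycle \<open>z\<close>. So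
  \<open>e\<close> chooses a representative in each homology class, in a way that depends linearly on the class
  and extends to all of \<open>C\<close>.

  For part a), a map \<open>g\<close> of homology is induced by \<open>f c = lift (g [e c])\<close>, where \<open>lift\<close> is the section
  \<open>[z] \<mapsto> e z\<close> of \<open>Z(D) \<rightarrow> H(D)\<close>. The values of \<open>f\<close> are cycles and \<open>f\<close> kills boundaries, so
  \<open>\<partial> f = 0\<close> (lemma \<open>induced_surj\<close>).

  For part b), let \<open>f\<close> have degree \<open>i\<close>, with \<open>\<partial> f = (-1)\<^sup>i f \<partial>\<close> and \<open>f\<close> mapping cycles to
  boundaries, and let \<open>u = h f e + (-1)\<^sup>i f h\<close>. As \<open>f e\<close> has boundaries as values,
  \<open>\<partial> h f e = f e\<close>; as \<open>e \<partial> = 0\<close>, the differential of \<open>u\<close> in \<open>Hom(C, D)\<close> is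
  \<open>f e + f \<partial> h + f h \<partial> = f\<close> (lemma \<open>bd_nullhtp\<close>).

  Since \<open>u\<close> depends linearly on \<open>f\<close>, and since a boundary of \<open>Hom(C, D)\<close> maps cycles to boundaries,
  \<open>f \<mapsto> u\<close> is itself a map \<open>h\<close> as above for the dgmodule \<open>Hom(C, D)\<close>, which therefore satisfies
  assumption (A) (lemma \<open>Hom_split\<close>). The isomorphism is a restatement of a) as surjectivity and of
  b) as injectivity.\<close>

section \<open>Linear maps\<close>

lemma mod_hom_compose:
  assumes "f \<in> mod_hom R M N" "g \<in> mod_hom R N P"
  shows "(\<lambda>x. g (f x)) \<in> mod_hom R M P"
  using assms by (auto simp: mod_hom_def Pi_iff)

lemma mod_hom_add:
  assumes "module R N" "f \<in> mod_hom R M N" "g \<in> mod_hom R M N"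
  shows "(\<lambda>x. f x \<oplus>\<^bsub>N\<^esub> g x) \<in> mod_hom R M N"
proof -
  interpret N: module R N by fact
  show ?thesis
    using assms(2,3) by (auto simp: mod_hom_def Pi_iff N.M.a_ac N.smult_r_distr)
qed

lemma mod_hom_signed:
  assumes "module R N" "f \<in> mod_hom R M N"
  shows "(\<lambda>x. signed N i (f x)) \<in> mod_hom R M N"
proof -
  interpret N: module R N by fact
  show ?thesis
    using assms(2) by (auto simp: mod_hom_def signed_def Pi_iff N.M.minus_add N.smult_r_minus)
qed

lemma mod_hom_minus:
  assumes "module R N" "f \<in> mod_hom R M N" "g \<in> mod_hom R M N"
  shows "(\<lambda>x. f x \<ominus>\<^bsub>N\<^esub> g x) \<in> mod_hom R M N"
  \<comment> \<open>The sign of an odd degree is negation.\<close>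
  using mod_hom_add[OF assms(1,2) mod_hom_signed[OF assms(1,3), of 1]]
  by (simp add: signed_def a_minus_def)

lemma mod_hom_restrict:
  assumes "module R M" "f \<in> mod_hom R M N"
  shows "restrict f (carrier M) \<in> mod_hom R M N"
proof -
  interpret M: module R M by fact
  show ?thesis
    using assms(2) by (auto simp: mod_hom_def Pi_iff)
qed

lemma mod_hom_id: "(\<lambda>x. x) \<in> mod_hom R M M"
  by (auto simp: mod_hom_def)

text \<open>This gives linearity of maps that are known only through their values on classes
  \<open>p x\<close>: it is enough to check it on representatives.\<close>

lemma mod_hom_factor:
  assumes "module R M" and p: "p \<in> mod_hom R M N" "p ` carrier M = carrier N"
    and g: "g \<in> mod_hom R M P" and fp: "\<And>x. x \<in> carrier M \<Longrightarrow> f (p x) = g x"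
  shows "f \<in> mod_hom R N P"
proof -
  interpret M: module R M by fact
  note hom = mod_homD(2,3)[OF p(1), symmetric]
  have all: "(\<forall>x \<in> carrier N. Q x) \<longleftrightarrow> (\<forall>x \<in> carrier M. Q (p x))" for Q
    unfolding p(2)[symmetric] by auto
  have "\<forall>x \<in> carrier N. f x \<in> carrier P"
    unfolding all using mod_homD(1)[OF g] fp by simp
  moreover have "\<forall>x \<in> carrier N. \<forall>y \<in> carrier N. f (x \<oplus>\<^bsub>N\<^esub> y) = f x \<oplus>\<^bsub>P\<^esub> f y"
    unfolding all using mod_homD(2)[OF g] fp by (simp add: hom)
  moreover have "\<forall>a \<in> carrier R. \<forall>x \<in> carrier N. f (a \<odot>\<^bsub>N\<^esub> x) = a \<odot>\<^bsub>P\<^esub> f x"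
    unfolding all using mod_homD(3)[OF g] fp by (simp add: hom)
  ultimately show ?thesis by (simp add: mod_hom_def)
qed

lemma mod_hom_inj:
  assumes "module R M" "module R N" "f \<in> mod_hom R M N"
    and ker: "\<And>x. x \<in> carrier M \<Longrightarrow> f x = \<zero>\<^bsub>N\<^esub> \<Longrightarrow> x = \<zero>\<^bsub>M\<^esub>"
  shows "inj_on f (carrier M)"
proof (rule inj_onI)
  fix x y assume xy: "x \<in> carrier M" "y \<in> carrier M" "f x = f y"
  interpret M: module R M by fact
  interpret N: module R N by fact
  have "f (x \<oplus>\<^bsub>M\<^esub> \<ominus>\<^bsub>M\<^esub> y) = \<zero>\<^bsub>N\<^esub>"
    using xy mod_homD(1,2)[OF assms(3)] mod_hom_neg[OF assms(1-3)] by (simp add: N.M.r_neg)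
  then have "x \<oplus>\<^bsub>M\<^esub> \<ominus>\<^bsub>M\<^esub> y = \<zero>\<^bsub>M\<^esub>"
    using xy ker by simp
  then show "x = y"
    using xy M.M.minus_equality[of x "\<ominus>\<^bsub>M\<^esub> y"] by simp
qed

text \<open>The module axioms are equations between elements, or ask for an additive inverse, so they
  pass to the image of a linear map. Applied to \<open>z \<mapsto> [z]\<close>, this makes homology a module without any
  computation with cosets beyond the linearity of that map.\<close>

lemma module_surj_image:
  assumes "module R M" and f: "f \<in> mod_hom R M N"
    and surj: "f ` carrier M = carrier N" and zero: "f \<zero>\<^bsub>M\<^esub> = \<zero>\<^bsub>N\<^esub>"
  shows "module R N"
proof -
  interpret M: module R M by fact
  note f_add = mod_homD(2)[OF f, symmetric] and f_smult = mod_homD(3)[OF f, symmetric]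
  have all: "(\<forall>x \<in> carrier N. P x) \<longleftrightarrow> (\<forall>x \<in> carrier M. P (f x))" for P
    unfolding surj[symmetric] by auto
  have ex: "(\<exists>x \<in> carrier N. P x) \<longleftrightarrow> (\<exists>x \<in> carrier M. P (f x))" for P
    unfolding surj[symmetric] by auto
  have cl: "f x \<in> carrier N" if "x \<in> carrier M" for x
    using mod_homD(1)[OF f that] .
  have l_inv: "\<exists>y \<in> carrier M. f (y \<oplus>\<^bsub>M\<^esub> x) = f \<zero>\<^bsub>M\<^esub>" if "x \<in> carrier M" for x
    using that by (intro bexI[of _ "\<ominus>\<^bsub>M\<^esub> x"]) (simp_all add: M.M.l_neg)
  have g: "(\<forall>x \<in> carrier N. \<forall>y \<in> carrier N. x \<oplus>\<^bsub>N\<^esub> y \<in> carrier N) \<and>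
    (\<forall>x \<in> carrier N. \<forall>y \<in> carrier N. \<forall>z \<in> carrier N. x \<oplus>\<^bsub>N\<^esub> y \<oplus>\<^bsub>N\<^esub> z = x \<oplus>\<^bsub>N\<^esub> (y \<oplus>\<^bsub>N\<^esub> z)) \<and>
    (\<forall>x \<in> carrier N. \<forall>y \<in> carrier N. x \<oplus>\<^bsub>N\<^esub> y = y \<oplus>\<^bsub>N\<^esub> x) \<and>
    (\<forall>x \<in> carrier N. \<zero>\<^bsub>N\<^esub> \<oplus>\<^bsub>N\<^esub> x = x) \<and>
    (\<forall>x \<in> carrier N. \<exists>y \<in> carrier N. y \<oplus>\<^bsub>N\<^esub> x = \<zero>\<^bsub>N\<^esub>)"
    unfolding all ex zero[symmetric]
    using l_inv by (simp add: f_add cl M.M.a_assoc) (simp add: M.M.a_comm)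
  have s: "(\<forall>a \<in> carrier R. \<forall>x \<in> carrier N. a \<odot>\<^bsub>N\<^esub> x \<in> carrier N) \<and>
    (\<forall>a \<in> carrier R. \<forall>b \<in> carrier R. \<forall>x \<in> carrier N.
       (a \<oplus>\<^bsub>R\<^esub> b) \<odot>\<^bsub>N\<^esub> x = a \<odot>\<^bsub>N\<^esub> x \<oplus>\<^bsub>N\<^esub> b \<odot>\<^bsub>N\<^esub> x) \<and>
    (\<forall>a \<in> carrier R. \<forall>x \<in> carrier N. \<forall>y \<in> carrier N.
       a \<odot>\<^bsub>N\<^esub> (x \<oplus>\<^bsub>N\<^esub> y) = a \<odot>\<^bsub>N\<^esub> x \<oplus>\<^bsub>N\<^esub> a \<odot>\<^bsub>N\<^esub> y) \<and>
    (\<forall>a \<in> carrier R. \<forall>b \<in> carrier R. \<forall>x \<in> carrier N.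
       (a \<otimes>\<^bsub>R\<^esub> b) \<odot>\<^bsub>N\<^esub> x = a \<odot>\<^bsub>N\<^esub> (b \<odot>\<^bsub>N\<^esub> x)) \<and>
    (\<forall>x \<in> carrier N. \<one>\<^bsub>R\<^esub> \<odot>\<^bsub>N\<^esub> x = x)"
    unfolding all
    by (simp add: f_add f_smult cl M.smult_l_distr M.smult_r_distr M.smult_assoc1)
  have "abelian_group N"
    using g cl[OF M.M.zero_closed] zero by (intro abelian_groupI) auto
  then show ?thesis
    using s by (intro moduleI module.axioms(1)[OF assms(1)]) auto
qed

section \<open>Cycles and homology\<close>

lemma cycles_simps [simp]:
  "add (cycles C n) = add (grade C n)" "zero (cycles C n) = zero (grade C n)"
  "smult (cycles C n) = smult (grade C n)"
  by (simp_all add: cycles_def)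

lemma boundaries_simps [simp]:
  "add (boundaries C n) = add (grade C n)" "zero (boundaries C n) = zero (grade C n)"
  "smult (boundaries C n) = smult (grade C n)"
  by (simp_all add: boundaries_def)

lemma carrier_boundaries: "carrier (boundaries C n) = bd C (n + 1) ` carrier (grade C (n + 1))"
  by (simp add: boundaries_def)

lemma homology_simps:
  "X \<oplus>\<^bsub>homology C n\<^esub> Y = (\<Union>x \<in> X. \<Union>y \<in> Y. {x \<oplus>\<^bsub>grade C n\<^esub> y})"
  "a \<odot>\<^bsub>homology C n\<^esub> X = (\<Union>x \<in> X. hclass C n (a \<odot>\<^bsub>grade C n\<^esub> x))"
  "\<zero>\<^bsub>homology C n\<^esub> = carrier (boundaries C n)"
  by (auto simp: homology_def quot_mod_def set_add_defs hclass_def set_mult_def)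

context dgmodule
begin

lemma cycles_module: "module R (cycles C n)"
proof -
  interpret M: module R "grade C n" by (rule grade_module)
  interpret N: module R "grade C (n - 1)" by (rule grade_module)
  note h = bd_hom[of n]
  have "submodule (a_kernel (grade C n) (grade C (n - 1)) (bd C n)) R (grade C n)"
    using mod_homD[OF h] mod_hom_zero[OF grade_module grade_module h]
      mod_hom_neg[OF grade_module grade_module h]
    by (intro M.submoduleI) (auto simp: a_kernel_def kernel_def)
  then show ?thesis unfolding cycles_def
    by (rule submodule.submodule_is_module) (rule grade_module)
qed

lemma zero_homology: "\<zero>\<^bsub>homology C n\<^esub> = hclass C n \<zero>\<^bsub>grade C n\<^esub>"
proof -
  interpret M: module R "grade C n" by (rule grade_module)
  show ?thesis
    using bd_up(1) by (force simp: homology_simps hclass_eq carrier_boundaries)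
qed

lemma hclass_eq_zero_iff:
  assumes "z \<in> carrier (grade C n)"
  shows "hclass C n z = \<zero>\<^bsub>homology C n\<^esub> \<longleftrightarrow> z \<in> carrier (boundaries C n)"
proof
  interpret M: module R "grade C n" by (rule grade_module)
  show "z \<in> carrier (boundaries C n)" if "hclass C n z = \<zero>\<^bsub>homology C n\<^esub>"
    using self_in_hclass[OF assms] that by (simp add: homology_simps)
  show "hclass C n z = \<zero>\<^bsub>homology C n\<^esub>" if z: "z \<in> carrier (boundaries C n)"
  proof -
    obtain c where "c \<in> carrier (grade C (n + 1))" "z = bd C (n + 1) c"
      using z by (auto simp: carrier_boundaries)
    then show ?thesis
      using hclass_absorb[of c n "\<zero>\<^bsub>grade C n\<^esub>"] assms by (simp add: zero_homology)
  qed
qed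

lemma boundary_is_cycle: "b \<in> carrier (boundaries C n) \<Longrightarrow> b \<in> carrier (cycles C n)"
  using bd_up by (auto simp: carrier_boundaries carrier_cycles)

text \<open>Sums and multiples of classes are defined through all representatives at once. Changing the
  representatives by boundaries changes the sum and the multiple by boundaries, because \<open>\<partial>\<close> is
  linear.\<close>

lemma hclass_hom: "hclass C n \<in> mod_hom R (cycles C n) (homology C n)"
proof -
  interpret M: module R "grade C n" by (rule grade_module)
  interpret N: module R "grade C (n + 1)" by (rule grade_module)
  have hom: "bd C (n + 1) \<in> mod_hom R (grade C (n + 1)) (grade C n)"
    using bd_hom[of "n + 1"] by simp
  have add: "hclass C n (x \<oplus>\<^bsub>grade C n\<^esub> y) = hclass C n x \<oplus>\<^bsub>homology C n\<^esub> hclass C n y"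
    if x: "x \<in> carrier (grade C n)" and y: "y \<in> carrier (grade C n)" for x y
  proof (intro equalityI subsetI)
    fix w assume "w \<in> hclass C n (x \<oplus>\<^bsub>grade C n\<^esub> y)"
    then obtain c where c: "c \<in> carrier (grade C (n + 1))"
      "w = bd C (n + 1) c \<oplus>\<^bsub>grade C n\<^esub> (x \<oplus>\<^bsub>grade C n\<^esub> y)"
      by (auto simp: hclass_eq)
    have "w = (bd C (n + 1) c \<oplus>\<^bsub>grade C n\<^esub> x) \<oplus>\<^bsub>grade C n\<^esub> y"
      using c x y bd_up(1) by (simp add: M.M.a_assoc)
    moreover have "bd C (n + 1) c \<oplus>\<^bsub>grade C n\<^esub> x \<in> hclass C n x"
      using c by (auto simp: hclass_eq)
    ultimately show "w \<in> hclass C n x \<oplus>\<^bsub>homology C n\<^esub> hclass C n y"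
      using self_in_hclass[OF y] by (auto simp: homology_simps)
  next
    fix w assume "w \<in> hclass C n x \<oplus>\<^bsub>homology C n\<^esub> hclass C n y"
    then obtain c c' where c: "c \<in> carrier (grade C (n + 1))" "c' \<in> carrier (grade C (n + 1))"
      "w = (bd C (n + 1) c \<oplus>\<^bsub>grade C n\<^esub> x) \<oplus>\<^bsub>grade C n\<^esub> (bd C (n + 1) c' \<oplus>\<^bsub>grade C n\<^esub> y)"
      by (auto simp: homology_simps hclass_eq)
    have "w = bd C (n + 1) (c \<oplus>\<^bsub>grade C (n + 1)\<^esub> c') \<oplus>\<^bsub>grade C n\<^esub> (x \<oplus>\<^bsub>grade C n\<^esub> y)"
      using c x y bd_up(1) by (simp add: mod_homD(2)[OF hom] M.M.a_ac)
    then show "w \<in> hclass C n (x \<oplus>\<^bsub>grade C n\<^esub> y)"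
      using c by (auto simp: hclass_eq)
  qed
  have smult: "hclass C n (a \<odot>\<^bsub>grade C n\<^esub> x) = a \<odot>\<^bsub>homology C n\<^esub> hclass C n x"
    if a: "a \<in> carrier R" and x: "x \<in> carrier (grade C n)" for a x
  proof -
    have "hclass C n (a \<odot>\<^bsub>grade C n\<^esub> y) = hclass C n (a \<odot>\<^bsub>grade C n\<^esub> x)"
      if y: "y \<in> hclass C n x" for y
    proof -
      obtain c where c: "c \<in> carrier (grade C (n + 1))" "y = bd C (n + 1) c \<oplus>\<^bsub>grade C n\<^esub> x"
        using y by (auto simp: hclass_eq)
      have "a \<odot>\<^bsub>grade C n\<^esub> y =
          bd C (n + 1) (a \<odot>\<^bsub>grade C (n + 1)\<^esub> c) \<oplus>\<^bsub>grade C n\<^esub> a \<odot>\<^bsub>grade C n\<^esub> x"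
        using a x c bd_up(1) by (simp add: mod_homD(3)[OF hom] M.smult_r_distr)
      then show ?thesis
        using hclass_absorb a c x by simp
    qed
    then have "(\<Union>y \<in> hclass C n x. hclass C n (a \<odot>\<^bsub>grade C n\<^esub> y)) = hclass C n (a \<odot>\<^bsub>grade C n\<^esub> x)"
      using self_in_hclass[OF x] by blast
    then show ?thesis
      by (simp add: homology_simps)
  qed
  show ?thesis
    using add smult by (auto simp: mod_hom_def carrier_homology carrier_cycles)
qed

lemma homology_module: "module R (homology C n)"
  using module_surj_image[OF cycles_module hclass_hom carrier_homology[symmetric]]
  by (simp add: zero_homology)

lemma mod_hom_from_homology:
  assumes "g \<in> mod_hom R (cycles C n) P"
    and "\<And>z. z \<in> carrier (cycles C n) \<Longrightarrow> f (hclass C n z) = g z"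
  shows "f \<in> mod_hom R (homology C n) P"
  using cycles_module hclass_hom carrier_homology[symmetric] assms by (rule mod_hom_factor)

text \<open>With this, \<open>Hom(H(C), H(D))\<close> is a module because every \<open>Hom\<close> of dgmodules is one.\<close>

lemma zero_bd_homology_dgmodule: "dgmodule R (zero_bd (homology C))"
proof -
  have zero: "(\<lambda>_. \<zero>\<^bsub>homology C (n - 1)\<^esub>) \<in> mod_hom R (homology C n) (homology C (n - 1))" for n
  proof -
    interpret M: module R "homology C (n - 1)" by (rule homology_module)
    show ?thesis by (auto simp: mod_hom_def)
  qed
  show ?thesis
    by (intro dgmodule.intro dgmodule_axioms.intro cring_axioms)
      (simp_all add: zero_bd_def homology_module zero del: diff_diff_eq diff_diff_add)
qed

end

section \<open>Split dgmodules\<close>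

text \<open>This is assumption (A) without submodules or quotients: the differential has a generalized
  inverse \<open>h\<close>.\<close>

locale split_dgmodule = dgmodule +
  fixes h :: "int \<Rightarrow> 'c \<Rightarrow> 'c"
  assumes h_hom: "h n \<in> mod_hom R (grade C n) (grade C (n + 1))"
    and bd_h_bd: "c \<in> carrier (grade C n) \<Longrightarrow> bd C n (h (n - 1) (bd C n c)) = bd C n c"
begin

text \<open>The map \<open>e = 1 - \<partial> h - h \<partial>\<close>, homotopic to the identity by construction. Its restriction
  to cycles is \<open>1 - \<partial> h\<close>, a change of representative within the homology class.\<close>

definition hproj :: "int \<Rightarrow> 'c \<Rightarrow> 'c"
  where "hproj n c = c \<ominus>\<^bsub>grade C n\<^esub> (bd C (n + 1) (h n c) \<oplus>\<^bsub>grade C n\<^esub> h (n - 1) (bd C n c))"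

lemma bd_h_hom: "(\<lambda>c. bd C (n + 1) (h n c)) \<in> mod_hom R (grade C n) (grade C n)"
  using mod_hom_compose[OF h_hom bd_hom, of n] by simp

lemma h_bd_hom: "(\<lambda>c. h (n - 1) (bd C n c)) \<in> mod_hom R (grade C n) (grade C n)"
  using mod_hom_compose[OF bd_hom h_hom[of "n - 1"]] by simp

lemma hproj_hom: "hproj n \<in> mod_hom R (grade C n) (grade C n)"
  unfolding hproj_def
  by (intro mod_hom_minus mod_hom_add mod_hom_id grade_module bd_h_hom h_bd_hom)

lemma hproj_closed: "c \<in> carrier (grade C n) \<Longrightarrow> hproj n c \<in> carrier (grade C n)"
  using mod_homD(1)[OF hproj_hom] .

lemma hproj_decomp:
  assumes "c \<in> carrier (grade C n)"
  shows "hproj n c \<oplus>\<^bsub>grade C n\<^esub> (bd C (n + 1) (h n c) \<oplus>\<^bsub>grade C n\<^esub> h (n - 1) (bd C n c)) = c"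
proof -
  interpret M: module R "grade C n" by (rule grade_module)
  show ?thesis
    using assms mod_homD(1)[OF bd_h_hom assms] mod_homD(1)[OF h_bd_hom assms]
    by (simp add: hproj_def M.M.minus_eq M.M.a_assoc M.M.l_neg)
qed

text \<open>By \<open>\<partial> \<partial> = 0\<close> and \<open>\<partial> h \<partial> = \<partial>\<close>, one has \<open>\<partial> e = \<partial> - \<partial> \<partial> h - \<partial> h \<partial> = 0\<close>. The proof applies
  \<open>\<partial>\<close> to \<open>c = e c + (\<partial> h c + h \<partial> c)\<close> and cancels \<open>\<partial> c\<close>, which avoids differences.\<close>

lemma hproj_cycle:
  assumes c: "c \<in> carrier (grade C n)"
  shows "hproj n c \<in> carrier (cycles C n)"
proof -
  interpret N: module R "grade C (n - 1)" by (rule grade_module)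
  note [simp] = mod_homD(1)[OF bd_h_hom c] mod_homD(1)[OF h_bd_hom c] mod_homD(1)[OF bd_hom c]
    hproj_closed[OF c]
  have hc: "h n c \<in> carrier (grade C (n + 1))"
    using mod_homD(1)[OF h_hom c] .
  interpret M: module R "grade C n" by (rule grade_module)
  have "bd C n c = bd C n (hproj n c) \<oplus>\<^bsub>grade C (n - 1)\<^esub>
      (bd C n (bd C (n + 1) (h n c)) \<oplus>\<^bsub>grade C (n - 1)\<^esub> bd C n (h (n - 1) (bd C n c)))"
    by (subst (1) hproj_decomp[OF c, symmetric])
      (simp only: mod_homD(2)[OF bd_hom] M.a_closed mod_homD(1)[OF bd_h_hom c]
         mod_homD(1)[OF h_bd_hom c] hproj_closed[OF c])
  then have "bd C n c = bd C n (hproj n c) \<oplus>\<^bsub>grade C (n - 1)\<^esub> bd C n c"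
    using bd_up(2)[OF hc] by (simp add: bd_h_bd[OF c])
  then show ?thesis
    using mod_homD(1)[OF bd_hom hproj_closed[OF c]] mod_homD(1)[OF bd_hom c] hproj_closed[OF c]
    by (simp add: carrier_cycles)
qed

lemma hproj_of_cycle:
  assumes "z \<in> carrier (cycles C n)"
  shows "hproj n z = z \<ominus>\<^bsub>grade C n\<^esub> bd C (n + 1) (h n z)"
proof -
  interpret M: module R "grade C n" by (rule grade_module)
  have "h (n - 1) \<zero>\<^bsub>grade C (n - 1)\<^esub> = \<zero>\<^bsub>grade C n\<^esub>"
    using mod_hom_zero[OF grade_module grade_module h_hom[of "n - 1"]] by simp
  then show ?thesis
    using assms mod_homD(1)[OF bd_h_hom] by (simp add: hproj_def carrier_cycles)
qed

lemma bd_h_boundary: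
  assumes "b \<in> carrier (boundaries C n)"
  shows "bd C (n + 1) (h n b) = b"
  using assms bd_h_bd[of _ "n + 1"] by (auto simp: carrier_boundaries)

lemma hproj_boundary:
  assumes "b \<in> carrier (boundaries C n)"
  shows "hproj n b = \<zero>\<^bsub>grade C n\<^esub>"
proof -
  interpret M: module R "grade C n" by (rule grade_module)
  show ?thesis
    using boundary_is_cycle[OF assms] hproj_of_cycle bd_h_boundary[OF assms]
    by (simp add: carrier_cycles M.M.minus_eq M.M.r_neg)
qed

lemma hclass_hproj:
  assumes z: "z \<in> carrier (cycles C n)"
  shows "hclass C n (hproj n z) = hclass C n z"
proof -
  interpret M: module R "grade C n" by (rule grade_module)
  have zc: "z \<in> carrier (grade C n)" using z by (simp add: carrier_cycles)
  have "z = bd C (n + 1) (h n z) \<oplus>\<^bsub>grade C n\<^esub> hproj n z"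
    using hproj_of_cycle[OF z] zc mod_homD(1)[OF bd_h_hom zc]
    by (simp add: M.M.minus_eq M.M.a_lcomm[of "bd C (n + 1) (h n z)" z] M.M.r_neg)
  then show ?thesis
    using hclass_absorb[OF mod_homD(1)[OF h_hom zc] hproj_closed[OF zc]] by simp
qed

text \<open>Since \<open>e\<close> kills boundaries, it is constant on each class of cycles; its value there is the
  chosen representative of the class.\<close>

definition lift :: "int \<Rightarrow> 'c set \<Rightarrow> 'c"
  where "lift n X = the_elem (hproj n ` X)"

lemma lift_hclass:
  assumes z: "z \<in> carrier (cycles C n)"
  shows "lift n (hclass C n z) = hproj n z"
  unfolding lift_def
proof (rule the_elem_image_eq)
  interpret M: module R "grade C n" by (rule grade_module)
  have zc: "z \<in> carrier (grade C n)" using z by (simp add: carrier_cycles)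
  then show "z \<in> hclass C n z" by (rule self_in_hclass)
  fix y assume "y \<in> hclass C n z"
  then obtain c where c: "c \<in> carrier (grade C (n + 1))" "y = bd C (n + 1) c \<oplus>\<^bsub>grade C n\<^esub> z"
    by (auto simp: hclass_eq)
  moreover have "hproj n (bd C (n + 1) c) = \<zero>\<^bsub>grade C n\<^esub>"
    using c by (intro hproj_boundary) (simp add: carrier_boundaries)
  ultimately show "hproj n y = hproj n z"
    using zc bd_up(1)[OF c(1)] hproj_closed by (simp add: mod_homD(2)[OF hproj_hom])
qed

lemma lift_hom: "lift n \<in> mod_hom R (homology C n) (cycles C n)"
proof (rule mod_hom_from_homology)
  show "hproj n \<in> mod_hom R (cycles C n) (cycles C n)"
    using hproj_hom[of n] hproj_cycle by (auto simp: mod_hom_def carrier_cycles)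
qed (rule lift_hclass)

lemma hclass_lift:
  assumes "X \<in> carrier (homology C n)"
  shows "hclass C n (lift n X) = X"
  using assms by (auto simp: carrier_homology lift_hclass hclass_hproj)

text \<open>The sections are \<open>h\<close> itself, restricted to boundaries, and \<open>lift\<close>.\<close>

lemma split_imp_assumption_A: "assumption_A R C"
proof -
  have "split_exact R (cycles C n) (\<lambda>z. z) (grade C n) (bd C n) (boundaries C (n - 1))" for n
  proof -
    have s: "h (n - 1) \<in> mod_hom R (boundaries C (n - 1)) (grade C n)"
      using h_hom[of "n - 1"] bd_hom[of n]
      by (auto simp: mod_hom_def carrier_boundaries Pi_iff)
    have "\<forall>b \<in> carrier (boundaries C (n - 1)). bd C n (h (n - 1) b) = b"
      using bd_h_bd by (auto simp: carrier_boundaries)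
    with s show ?thesis
      using bd_hom[of n]
      by (auto simp: split_exact_def mod_hom_def carrier_cycles carrier_boundaries
          a_kernel_def kernel_def)
  qed
  moreover have "split_exact R (boundaries C n) (\<lambda>b. b) (cycles C n) (hclass C n) (homology C n)" for n
  proof -
    have "(\<lambda>b. b) \<in> mod_hom R (boundaries C n) (cycles C n)"
      using boundary_is_cycle by (auto simp: mod_hom_def)
    moreover have "carrier (boundaries C n) = a_kernel (cycles C n) (homology C n) (hclass C n)"
      using hclass_eq_zero_iff boundary_is_cycle
      by (auto simp: a_kernel_def kernel_def carrier_cycles)
    ultimately show ?thesis
      unfolding split_exact_def using hclass_hom lift_hom hclass_lift carrier_homology[of C n]
      by (intro conjI bexI[of _ "lift n"]) simp_all
  qed
  ultimately show ?thesis
    by (simp add: assumption_A_def)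
qed

end

text \<open>Let \<open>s\<close> and \<open>t\<close> be sections of \<open>C \<rightarrow> B(C)\<close> and \<open>Z(C) \<rightarrow> H(C)\<close>. Then \<open>q = 1 - s \<partial>\<close> projects
  \<open>C\<close> onto \<open>Z(C)\<close>, and \<open>z \<mapsto> z - t [z]\<close> projects \<open>Z(C)\<close> onto \<open>B(C)\<close>. Their composite \<open>p\<close> has values in
  \<open>B(C)\<close> and fixes boundaries, so \<open>h = s p\<close> satisfies \<open>\<partial> h \<partial> = \<partial> s \<partial> = \<partial>\<close>.\<close>

lemma assumption_A_obtains_split:
  assumes "dgmodule R C" and A: "assumption_A R C"
  obtains h where "split_dgmodule R C h"
proof -
  interpret dgmodule R C by fact
  have "\<exists>s \<in> mod_hom R (boundaries C (n - 1)) (grade C n). \<forall>b \<in> carrier (boundaries C (n - 1)). bd C n (s b) = b"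
    for n using A unfolding assumption_A_def split_exact_def by blast
  then obtain s where s: "\<And>n. s n \<in> mod_hom R (boundaries C (n - 1)) (grade C n)"
    and bd_s: "\<And>n b. b \<in> carrier (boundaries C (n - 1)) \<Longrightarrow> bd C n (s n b) = b"
    by metis
  have "\<exists>t \<in> mod_hom R (homology C n) (cycles C n). \<forall>X \<in> carrier (homology C n). hclass C n (t X) = X"
    for n using A by (simp add: assumption_A_def split_exact_def)
  then obtain t where t: "\<And>n. t n \<in> mod_hom R (homology C n) (cycles C n)"
    and hclass_t: "\<And>n X. X \<in> carrier (homology C n) \<Longrightarrow> hclass C n (t n X) = X"
    by metis
  define q where "q n c = c \<ominus>\<^bsub>grade C n\<^esub> s n (bd C n c)" for n c
  define p where "p n c = q n c \<ominus>\<^bsub>grade C n\<^esub> t n (hclass C n (q n c))" for n c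
  have bd_b: "bd C n \<in> mod_hom R (grade C n) (boundaries C (n - 1))" for n
    using bd_hom[of n] by (auto simp: mod_hom_def carrier_boundaries)
  have q_hom: "q n \<in> mod_hom R (grade C n) (grade C n)" for n
    unfolding q_def by (intro mod_hom_minus mod_hom_id grade_module mod_hom_compose[OF bd_b s])
  have q_cycle: "q n c \<in> carrier (cycles C n)" if c: "c \<in> carrier (grade C n)" for n c
  proof -
    interpret M: module R "grade C n" by (rule grade_module)
    interpret N: module R "grade C (n - 1)" by (rule grade_module)
    have b: "bd C n c \<in> carrier (boundaries C (n - 1))" using mod_homD(1)[OF bd_b c] .
    show ?thesis
      using c mod_homD(1)[OF q_hom c] bd_s[OF b] mod_homD(1)[OF s b] mod_homD(1)[OF bd_hom c]
        mod_homD(2)[OF bd_hom] mod_hom_neg[OF grade_module grade_module bd_hom]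
      by (simp add: carrier_cycles q_def M.M.minus_eq N.M.r_neg)
  qed
  have q_hom': "q n \<in> mod_hom R (grade C n) (cycles C n)" for n
    using q_hom[of n] q_cycle by (auto simp: mod_hom_def)
  have t_hom': "t n \<in> mod_hom R (homology C n) (grade C n)" for n
    using t[of n] by (auto simp: mod_hom_def carrier_cycles)
  have p_hom: "p n \<in> mod_hom R (grade C n) (grade C n)" for n
    unfolding p_def
    by (intro mod_hom_minus grade_module q_hom
        mod_hom_compose[OF mod_hom_compose[OF q_hom' hclass_hom] t_hom'])
  have p_boundary: "p n c \<in> carrier (boundaries C n)" if c: "c \<in> carrier (grade C n)" for n c
  proof -
    interpret M: module R "grade C n" by (rule grade_module)
    interpret H: module R "homology C n" by (rule homology_module)
    define X where "X = hclass C n (q n c)"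
    have X: "X \<in> carrier (homology C n)"
      using q_cycle[OF c] by (simp add: X_def carrier_homology)
    have tX: "t n X \<in> carrier (cycles C n)" using mod_homD(1)[OF t X] .
    have neg: "hclass C n (\<ominus>\<^bsub>cycles C n\<^esub> t n X) = \<ominus>\<^bsub>homology C n\<^esub> X"
      using mod_hom_neg[OF cycles_module homology_module hclass_hom tX] hclass_t[OF X] by simp
    interpret Z: module R "cycles C n" by (rule cycles_module)
    \<comment> \<open>Negation in a record refers to its carrier, so in the cycles it is a different term.\<close>
    have ng: "\<ominus>\<^bsub>cycles C n\<^esub> t n X = \<ominus>\<^bsub>grade C n\<^esub> t n X"
      using mod_hom_neg[OF cycles_module grade_module _ tX, of "\<lambda>z. z"]
      by (auto simp: mod_hom_def carrier_cycles)
    have "hclass C n (p n c) = hclass C n (q n c) \<oplus>\<^bsub>homology C n\<^esub> \<ominus>\<^bsub>homology C n\<^esub> X"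
      using mod_homD(2)[OF hclass_hom q_cycle[OF c], of "\<ominus>\<^bsub>cycles C n\<^esub> t n X"] Z.M.a_inv_closed[OF tX] neg
      by (simp add: p_def X_def[symmetric] M.M.minus_eq ng)
    then have "hclass C n (p n c) = \<zero>\<^bsub>homology C n\<^esub>"
      using X by (simp add: X_def[symmetric] H.M.r_neg)
    then show ?thesis
      using hclass_eq_zero_iff mod_homD(1)[OF p_hom c] by blast
  qed
  have p_id: "p n (bd C (n + 1) c) = bd C (n + 1) c" if c: "c \<in> carrier (grade C (n + 1))" for n c
  proof -
    interpret M: module R "grade C n" by (rule grade_module)
    let ?b = "bd C (n + 1) c"
    have b: "?b \<in> carrier (boundaries C n)" using c by (simp add: carrier_boundaries)
    have bc: "?b \<in> carrier (grade C n)" using bd_up(1)[OF c] .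
    have "s n \<zero>\<^bsub>grade C (n - 1)\<^esub> = \<zero>\<^bsub>grade C n\<^esub>"
    proof -
      interpret Z: module R "cycles C n" by (rule cycles_module)
      have "s n (bd C n \<zero>\<^bsub>grade C n\<^esub>) = \<zero>\<^bsub>grade C n\<^esub>"
        by (rule mod_hom_zero[OF grade_module grade_module mod_hom_compose[OF bd_b s]])
      then show ?thesis
        using mod_hom_zero[OF grade_module grade_module bd_hom, of n] by simp
    qed
    then have "q n ?b = ?b"
      using bd_up(2)[OF c] bc by (simp add: q_def M.M.minus_eq)
    moreover have "hclass C n ?b = \<zero>\<^bsub>homology C n\<^esub>"
      using b bc hclass_eq_zero_iff by blast
    moreover have "t n \<zero>\<^bsub>homology C n\<^esub> = \<zero>\<^bsub>grade C n\<^esub>"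
      by (rule mod_hom_zero[OF homology_module grade_module t_hom'])
    ultimately show ?thesis
      using bc by (simp add: p_def M.M.minus_eq)
  qed
  have "split_dgmodule R C (\<lambda>n c. s (n + 1) (p n c))"
  proof (intro split_dgmodule.intro split_dgmodule_axioms.intro dgmodule_axioms)
    show "(\<lambda>c. s (n + 1) (p n c)) \<in> mod_hom R (grade C n) (grade C (n + 1))" for n
    proof -
      have "p n \<in> mod_hom R (grade C n) (boundaries C n)"
        using p_hom[of n] p_boundary by (auto simp: mod_hom_def)
      then show ?thesis
        using s[of "n + 1"] by (simp add: mod_hom_compose)
    qed
    show "bd C n (s (n - 1 + 1) (p (n - 1) (bd C n c))) = bd C n c" if "c \<in> carrier (grade C n)" for n c
      using p_id[of c "n - 1"] that bd_s[of "bd C n c" n] mod_homD(1)[OF bd_b that] by simp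
  qed
  then show ?thesis by (rule that)
qed

section \<open>The dgmodule of homomorphisms\<close>

lemma signed_closed:
  assumes "module R M" "x \<in> carrier M"
  shows "signed M i x \<in> carrier M"
  using mod_homD(1)[OF mod_hom_signed[OF assms(1) mod_hom_id] assms(2)] .

lemma signed_signed:
  assumes "module R M" "x \<in> carrier M"
  shows "signed M i (signed M i x) = x"
proof -
  interpret M: module R M by fact
  show ?thesis using assms(2) by (simp add: signed_def)
qed

lemma minus_signed_succ:
  assumes "module R M" "y \<in> carrier M"
  shows "x \<ominus>\<^bsub>M\<^esub> signed M (i + 1) y = x \<oplus>\<^bsub>M\<^esub> signed M i y"
proof -
  interpret M: module R M by fact
  show ?thesis using assms(2) by (simp add: signed_def M.M.minus_eq)
qed

lemma mod_hom_signed_commute: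
  assumes "module R M" "module R N" "f \<in> mod_hom R M N" "x \<in> carrier M"
  shows "f (signed M i x) = signed N i (f x)"
  using mod_hom_neg[OF assms] by (simp add: signed_def)

lemma Hom_gradeD:
  assumes "f \<in> carrier (Hom_grade R C D i)"
  shows "f n \<in> mod_hom R (grade C n) (grade D (n + i))" "f n \<in> extensional (carrier (grade C n))"
  using assms by (auto simp: Hom_grade_def)

lemma Hom_grade_eqI:
  assumes "f \<in> carrier (Hom_grade R C D i)" "g \<in> carrier (Hom_grade R C D i)"
    and "\<And>n c. c \<in> carrier (grade C n) \<Longrightarrow> f n c = g n c"
  shows "f = g"
  using extensionalityI[OF Hom_gradeD(2)[OF assms(1)] Hom_gradeD(2)[OF assms(2)] assms(3)]
  by blast

lemma Hom_grade_apply: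
  assumes "c \<in> carrier (grade C n)"
  shows "(f \<oplus>\<^bsub>Hom_grade R C D i\<^esub> g) n c = f n c \<oplus>\<^bsub>grade D (n + i)\<^esub> g n c"
    and "(a \<odot>\<^bsub>Hom_grade R C D i\<^esub> f) n c = a \<odot>\<^bsub>grade D (n + i)\<^esub> f n c"
    and "\<zero>\<^bsub>Hom_grade R C D i\<^esub> n c = \<zero>\<^bsub>grade D (n + i)\<^esub>"
  using assms by (simp_all add: Hom_grade_def)

lemma Hom_dg_simps [simp]:
  "grade (Hom_dg R C D) = Hom_grade R C D" "bd (Hom_dg R C D) = Hom_bd C D"
  by (simp_all add: Hom_dg_def)

locale dgmodule_pair = C: dgmodule R C + D: dgmodule R D
  for R :: "('a, 'r) ring_scheme" and C :: "('a, 'c) dgm" and D :: "('a, 'd) dgm"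
begin

lemma Hom_gradeI:
  assumes "\<And>n. f n \<in> mod_hom R (grade C n) (grade D (n + i))"
  shows "(\<lambda>n. restrict (f n) (carrier (grade C n))) \<in> carrier (Hom_grade R C D i)"
  using mod_hom_restrict[OF C.grade_module assms] by (simp add: Hom_grade_def)

lemma Hom_grade_closed:
  assumes "f \<in> carrier (Hom_grade R C D i)"
  shows "c \<in> carrier (grade C n) \<Longrightarrow> f n c \<in> carrier (grade D (n + i))"
  using mod_homD(1)[OF Hom_gradeD(1)[OF assms]] .

lemma Hom_grade_module: "module R (Hom_grade R C D i)"
proof -
  let ?H = "Hom_grade R C D i"
  note ap = Hom_grade_apply and cl = Hom_grade_closed
  have addc: "f \<oplus>\<^bsub>?H\<^esub> g \<in> carrier ?H" if "f \<in> carrier ?H" "g \<in> carrier ?H" for f g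
    using Hom_gradeI[of "\<lambda>n c. f n c \<oplus>\<^bsub>grade D (n + i)\<^esub> g n c" i,
        OF mod_hom_add[OF D.grade_module Hom_gradeD(1)[OF that(1)] Hom_gradeD(1)[OF that(2)]]]
    by (simp add: Hom_grade_def)
  have zeroc: "\<zero>\<^bsub>?H\<^esub> \<in> carrier ?H"
  proof -
    have "(\<lambda>_. \<zero>\<^bsub>grade D (n + i)\<^esub>) \<in> mod_hom R (grade C n) (grade D (n + i))" for n
    proof -
      interpret M: module R "grade D (n + i)" by (rule D.grade_module)
      show ?thesis by (auto simp: mod_hom_def)
    qed
    from Hom_gradeI[of "\<lambda>n _. \<zero>\<^bsub>grade D (n + i)\<^esub>" i, OF this] show ?thesis
      by (simp add: Hom_grade_def)
  qed
  have smultc: "a \<odot>\<^bsub>?H\<^esub> f \<in> carrier ?H" if a: "a \<in> carrier R" and f: "f \<in> carrier ?H" for a f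
  proof -
    \<comment> \<open>A multiple of a linear map is linear because \<open>R\<close> is commutative.\<close>
    have "(\<lambda>c. a \<odot>\<^bsub>grade D (n + i)\<^esub> f n c) \<in> mod_hom R (grade C n) (grade D (n + i))" for n
    proof -
      interpret M: module R "grade D (n + i)" by (rule D.grade_module)
      show ?thesis
        using Hom_gradeD(1)[OF f, of n] a
        by (auto simp: mod_hom_def Pi_iff M.smult_r_distr M.smult_assoc1[symmetric] C.m_comm)
    qed
    from Hom_gradeI[of "\<lambda>n c. a \<odot>\<^bsub>grade D (n + i)\<^esub> f n c" i, OF this] show ?thesis
      by (simp add: Hom_grade_def)
  qed
  have negc: "\<exists>g \<in> carrier ?H. g \<oplus>\<^bsub>?H\<^esub> f = \<zero>\<^bsub>?H\<^esub>" if f: "f \<in> carrier ?H" for f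
  proof -
    let ?g = "\<lambda>n. \<lambda>c \<in> carrier (grade C n). signed (grade D (n + i)) 1 (f n c)"
    have g: "?g \<in> carrier ?H"
      by (intro Hom_gradeI mod_hom_signed D.grade_module Hom_gradeD(1)[OF f])
    have "?g \<oplus>\<^bsub>?H\<^esub> f = \<zero>\<^bsub>?H\<^esub>"
    proof (rule Hom_grade_eqI[OF addc[OF g f] zeroc])
      fix n c assume c: "c \<in> carrier (grade C n)"
      interpret M: module R "grade D (n + i)" by (rule D.grade_module)
      show "(?g \<oplus>\<^bsub>?H\<^esub> f) n c = \<zero>\<^bsub>?H\<^esub> n c"
        using c cl[OF f c] by (simp add: ap signed_def M.M.l_neg)
    qed
    with g show ?thesis by blast
  qed
  have "abelian_group ?H"
  proof (rule abelian_groupI)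
    fix f g k assume f: "f \<in> carrier ?H" and g: "g \<in> carrier ?H" and k: "k \<in> carrier ?H"
    show "f \<oplus>\<^bsub>?H\<^esub> g \<oplus>\<^bsub>?H\<^esub> k = f \<oplus>\<^bsub>?H\<^esub> (g \<oplus>\<^bsub>?H\<^esub> k)"
    proof (rule Hom_grade_eqI[OF addc[OF addc[OF f g] k] addc[OF f addc[OF g k]]])
      fix n c assume c: "c \<in> carrier (grade C n)"
      interpret M: module R "grade D (n + i)" by (rule D.grade_module)
      show "(f \<oplus>\<^bsub>?H\<^esub> g \<oplus>\<^bsub>?H\<^esub> k) n c = (f \<oplus>\<^bsub>?H\<^esub> (g \<oplus>\<^bsub>?H\<^esub> k)) n c"
        using c cl[OF f c] cl[OF g c] cl[OF k c] by (simp add: ap M.M.a_assoc)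
    qed
  next
    fix f g assume f: "f \<in> carrier ?H" and g: "g \<in> carrier ?H"
    show "f \<oplus>\<^bsub>?H\<^esub> g = g \<oplus>\<^bsub>?H\<^esub> f"
    proof (rule Hom_grade_eqI[OF addc[OF f g] addc[OF g f]])
      fix n c assume c: "c \<in> carrier (grade C n)"
      interpret M: module R "grade D (n + i)" by (rule D.grade_module)
      show "(f \<oplus>\<^bsub>?H\<^esub> g) n c = (g \<oplus>\<^bsub>?H\<^esub> f) n c"
        using c cl[OF f c] cl[OF g c] by (simp add: ap M.M.a_comm)
    qed
  next
    fix f assume f: "f \<in> carrier ?H"
    show "\<zero>\<^bsub>?H\<^esub> \<oplus>\<^bsub>?H\<^esub> f = f"
    proof (rule Hom_grade_eqI[OF addc[OF zeroc f] f])
      fix n c assume c: "c \<in> carrier (grade C n)"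
      interpret M: module R "grade D (n + i)" by (rule D.grade_module)
      show "(\<zero>\<^bsub>?H\<^esub> \<oplus>\<^bsub>?H\<^esub> f) n c = f n c"
        using c cl[OF f c] by (simp add: ap)
    qed
  qed (use addc zeroc negc in auto)
  then show ?thesis
  proof (rule moduleI[OF C.is_cring])
    fix a b f assume a: "a \<in> carrier R" and b: "b \<in> carrier R" and f: "f \<in> carrier ?H"
    show "(a \<oplus>\<^bsub>R\<^esub> b) \<odot>\<^bsub>?H\<^esub> f = a \<odot>\<^bsub>?H\<^esub> f \<oplus>\<^bsub>?H\<^esub> b \<odot>\<^bsub>?H\<^esub> f"
    proof (rule Hom_grade_eqI[OF smultc[OF C.a_closed[OF a b] f] addc[OF smultc[OF a f] smultc[OF b f]]])
      fix n c assume c: "c \<in> carrier (grade C n)"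
      interpret M: module R "grade D (n + i)" by (rule D.grade_module)
      show "((a \<oplus>\<^bsub>R\<^esub> b) \<odot>\<^bsub>?H\<^esub> f) n c = (a \<odot>\<^bsub>?H\<^esub> f \<oplus>\<^bsub>?H\<^esub> b \<odot>\<^bsub>?H\<^esub> f) n c"
        using a b c cl[OF f c] by (simp add: ap M.smult_l_distr)
    qed
  next
    fix a f g assume a: "a \<in> carrier R" and f: "f \<in> carrier ?H" and g: "g \<in> carrier ?H"
    show "a \<odot>\<^bsub>?H\<^esub> (f \<oplus>\<^bsub>?H\<^esub> g) = a \<odot>\<^bsub>?H\<^esub> f \<oplus>\<^bsub>?H\<^esub> a \<odot>\<^bsub>?H\<^esub> g"
    proof (rule Hom_grade_eqI[OF smultc[OF a addc[OF f g]] addc[OF smultc[OF a f] smultc[OF a g]]])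
      fix n c assume c: "c \<in> carrier (grade C n)"
      interpret M: module R "grade D (n + i)" by (rule D.grade_module)
      show "(a \<odot>\<^bsub>?H\<^esub> (f \<oplus>\<^bsub>?H\<^esub> g)) n c = (a \<odot>\<^bsub>?H\<^esub> f \<oplus>\<^bsub>?H\<^esub> a \<odot>\<^bsub>?H\<^esub> g) n c"
        using a c cl[OF f c] cl[OF g c] by (simp add: ap M.smult_r_distr)
    qed
  next
    fix a b f assume a: "a \<in> carrier R" and b: "b \<in> carrier R" and f: "f \<in> carrier ?H"
    show "(a \<otimes>\<^bsub>R\<^esub> b) \<odot>\<^bsub>?H\<^esub> f = a \<odot>\<^bsub>?H\<^esub> (b \<odot>\<^bsub>?H\<^esub> f)"
    proof (rule Hom_grade_eqI[OF smultc[OF C.m_closed[OF a b] f] smultc[OF a smultc[OF b f]]])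
      fix n c assume c: "c \<in> carrier (grade C n)"
      interpret M: module R "grade D (n + i)" by (rule D.grade_module)
      show "((a \<otimes>\<^bsub>R\<^esub> b) \<odot>\<^bsub>?H\<^esub> f) n c = (a \<odot>\<^bsub>?H\<^esub> (b \<odot>\<^bsub>?H\<^esub> f)) n c"
        using a b c cl[OF f c] by (simp add: ap M.smult_assoc1)
    qed
  next
    fix f assume f: "f \<in> carrier ?H"
    show "\<one>\<^bsub>R\<^esub> \<odot>\<^bsub>?H\<^esub> f = f"
    proof (rule Hom_grade_eqI[OF smultc[OF C.one_closed f] f])
      fix n c assume c: "c \<in> carrier (grade C n)"
      interpret M: module R "grade D (n + i)" by (rule D.grade_module)
      show "(\<one>\<^bsub>R\<^esub> \<odot>\<^bsub>?H\<^esub> f) n c = f n c"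
        using c cl[OF f c] by (simp add: ap)
    qed
  qed (rule smultc)
qed

lemma post_bd_hom:
  assumes "f \<in> carrier (Hom_grade R C D i)"
  shows "(\<lambda>c. bd D (n + i) (f n c)) \<in> mod_hom R (grade C n) (grade D (n + i - 1))"
  using mod_hom_compose[OF Hom_gradeD(1)[OF assms] D.bd_hom] .

lemma pre_bd_hom:
  assumes "f \<in> carrier (Hom_grade R C D i)"
  shows "(\<lambda>c. f (n - 1) (bd C n c)) \<in> mod_hom R (grade C n) (grade D (n + i - 1))"
proof -
  have "n - 1 + i = n + i - 1" by simp
  then show ?thesis
    using mod_hom_compose[OF C.bd_hom[of n] Hom_gradeD(1)[OF assms, of "n - 1"]] by (simp only:)
qed

lemma Hom_bd_closed:
  assumes "f \<in> carrier (Hom_grade R C D i)"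
  shows "Hom_bd C D i f \<in> carrier (Hom_grade R C D (i - 1))"
proof -
  have idx: "n + (i - 1) = n + i - 1" for n by simp
  show ?thesis
    unfolding Hom_bd_def
    by (rule Hom_gradeI, unfold idx)
      (intro mod_hom_minus mod_hom_signed D.grade_module post_bd_hom pre_bd_hom assms)
qed

lemma Hom_bd_hom: "Hom_bd C D i \<in> mod_hom R (Hom_grade R C D i) (Hom_grade R C D (i - 1))"
proof -
  interpret H: module R "Hom_grade R C D i" by (rule Hom_grade_module)
  interpret H': module R "Hom_grade R C D (i - 1)" by (rule Hom_grade_module)
  have idx: "n + (i - 1) = n + i - 1" "n - 1 + i = n + i - 1" for n by simp_all
  note ap = Hom_grade_apply
  have "Hom_bd C D i (f \<oplus>\<^bsub>Hom_grade R C D i\<^esub> g) =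
      Hom_bd C D i f \<oplus>\<^bsub>Hom_grade R C D (i - 1)\<^esub> Hom_bd C D i g"
    if f: "f \<in> carrier (Hom_grade R C D i)" and g: "g \<in> carrier (Hom_grade R C D i)" for f g
  proof (rule Hom_grade_eqI[OF Hom_bd_closed[OF H.a_closed[OF f g]]
        H'.a_closed[OF Hom_bd_closed[OF f] Hom_bd_closed[OF g]]])
    fix n c assume c: "c \<in> carrier (grade C n)"
    interpret M: module R "grade D (n + i - 1)" by (rule D.grade_module)
    note [simp] = mod_homD(1)[OF post_bd_hom c] mod_homD(1)[OF pre_bd_hom c]
    have bc: "bd C n c \<in> carrier (grade C (n - 1))" using mod_homD(1)[OF C.bd_hom c] .
    show "Hom_bd C D i (f \<oplus>\<^bsub>Hom_grade R C D i\<^esub> g) n c =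
        (Hom_bd C D i f \<oplus>\<^bsub>Hom_grade R C D (i - 1)\<^esub> Hom_bd C D i g) n c"
      using f g c bc Hom_grade_closed[OF f c] Hom_grade_closed[OF g c]
      by (simp add: ap idx Hom_bd_def signed_def M.M.minus_eq M.M.minus_add M.M.a_ac
          mod_homD(2)[OF D.bd_hom])
  qed
  moreover have "Hom_bd C D i (a \<odot>\<^bsub>Hom_grade R C D i\<^esub> f) =
      a \<odot>\<^bsub>Hom_grade R C D (i - 1)\<^esub> Hom_bd C D i f"
    if a: "a \<in> carrier R" and f: "f \<in> carrier (Hom_grade R C D i)" for a f
  proof (rule Hom_grade_eqI[OF Hom_bd_closed[OF H.smult_closed[OF a f]]
        H'.smult_closed[OF a Hom_bd_closed[OF f]]])
    fix n c assume c: "c \<in> carrier (grade C n)"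
    interpret M: module R "grade D (n + i - 1)" by (rule D.grade_module)
    note [simp] = mod_homD(1)[OF post_bd_hom c] mod_homD(1)[OF pre_bd_hom c]
    have bc: "bd C n c \<in> carrier (grade C (n - 1))" using mod_homD(1)[OF C.bd_hom c] .
    show "Hom_bd C D i (a \<odot>\<^bsub>Hom_grade R C D i\<^esub> f) n c =
        (a \<odot>\<^bsub>Hom_grade R C D (i - 1)\<^esub> Hom_bd C D i f) n c"
      using f a c bc Hom_grade_closed[OF f c]
      by (simp add: ap idx Hom_bd_def signed_def M.M.minus_eq M.smult_r_distr M.smult_r_minus
          mod_homD(3)[OF D.bd_hom])
  qed
  ultimately show ?thesis
    using Hom_bd_closed by (auto simp: mod_hom_def)
qed

text \<open>On a cycle only the term \<open>\<partial> f\<close> of the differential of \<open>f\<close> survives. In particular a cycle of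
  \<open>Hom(C, D)\<close> maps cycles to cycles, and a boundary of \<open>Hom(C, D)\<close> maps cycles to boundaries.\<close>

lemma Hom_bd_on_cycle:
  assumes f: "f \<in> carrier (Hom_grade R C D i)" and z: "z \<in> carrier (cycles C n)"
  shows "Hom_bd C D i f n z = bd D (n + i) (f n z)"
proof -
  interpret M: module R "grade D (n + i - 1)" by (rule D.grade_module)
  have idx: "n - 1 + i = n + i - 1" by simp
  have zc: "z \<in> carrier (grade C n)" using z by (simp add: carrier_cycles)
  have "f (n - 1) \<zero>\<^bsub>grade C (n - 1)\<^esub> = \<zero>\<^bsub>grade D (n + i - 1)\<^esub>"
    using mod_hom_zero[OF C.grade_module D.grade_module Hom_gradeD(1)[OF f]]
    by (simp only: idx flip: idx)
  then show ?thesis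
    using z zc mod_homD(1)[OF post_bd_hom[OF f] zc]
    by (simp add: Hom_bd_def carrier_cycles signed_def M.M.minus_eq)
qed

text \<open>With \<open>x = f c\<close> and \<open>y = f (\<partial> c)\<close>, the two terms that survive are \<open>-(-1)\<^sup>i \<partial> y\<close>, from
  applying \<open>\<partial>\<close> to \<open>\<partial> x - (-1)\<^sup>i y\<close>, and \<open>-(-1)\<^bsup>i-1\<^esup> \<partial> y\<close>, from evaluating at the cycle \<open>\<partial> c\<close>.\<close>

lemma Hom_bd_bd:
  assumes f: "f \<in> carrier (Hom_grade R C D i)"
  shows "Hom_bd C D (i - 1) (Hom_bd C D i f) = \<zero>\<^bsub>Hom_grade R C D (i - 1 - 1)\<^esub>"
proof (rule Hom_grade_eqI[OF Hom_bd_closed[OF Hom_bd_closed[OF f]]])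
  interpret H: module R "Hom_grade R C D (i - 1 - 1)" by (rule Hom_grade_module)
  show "\<zero>\<^bsub>Hom_grade R C D (i - 1 - 1)\<^esub> \<in> carrier (Hom_grade R C D (i - 1 - 1))"
    by (rule H.zero_closed)
  fix n c assume c: "c \<in> carrier (grade C n)"
  define m where "m = n + i - 1"
  have idx: "n + (i - 1) = m" "n - 1 + i = m" "m - 1 = n + (i - 1 - 1)" "n + i - 1 = m" "n + i = m + 1"
    by (simp_all add: m_def)
  let ?M = "grade D (m - 1)"
  interpret N: module R "grade D m" by (rule D.grade_module)
  interpret M: module R ?M by (rule D.grade_module)
  have bc: "bd C n c \<in> carrier (cycles C (n - 1))"
    using mod_homD(1)[OF C.bd_hom c] C.bd_bd[OF c] by (simp add: carrier_cycles)
  then have bcc: "bd C n c \<in> carrier (grade C (n - 1))" by (simp add: carrier_cycles)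
  define x where "x = f n c"
  define y where "y = f (n - 1) (bd C n c)"
  have x: "x \<in> carrier (grade D (m + 1))"
    using Hom_grade_closed[OF f c] by (simp only: x_def idx)
  have y: "y \<in> carrier (grade D m)"
    using Hom_grade_closed[OF f bcc] by (simp only: y_def idx)
  have sy: "signed (grade D m) i y \<in> carrier (grade D m)"
    by (rule signed_closed[OF D.grade_module y])
  have 1: "Hom_bd C D i f n c = bd D (m + 1) x \<ominus>\<^bsub>grade D m\<^esub> signed (grade D m) i y"
    using c by (simp add: Hom_bd_def x_def y_def idx)
  have 2: "Hom_bd C D i f (n - 1) (bd C n c) = bd D m y"
    using Hom_bd_on_cycle[OF f bc] by (simp only: y_def idx)
  have 3: "bd D m (Hom_bd C D i f n c) = \<ominus>\<^bsub>?M\<^esub> signed ?M i (bd D m y)"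
    using x y sy D.bd_up[OF x] mod_homD(2)[OF D.bd_hom, of "bd D (m + 1) x" m]
      mod_hom_neg[OF D.grade_module D.grade_module D.bd_hom sy]
      mod_hom_signed_commute[OF D.grade_module D.grade_module D.bd_hom y]
      signed_closed[OF D.grade_module mod_homD(1)[OF D.bd_hom y]]
    by (simp add: 1 N.M.minus_eq)
  show "Hom_bd C D (i - 1) (Hom_bd C D i f) n c = \<zero>\<^bsub>Hom_grade R C D (i - 1 - 1)\<^esub> n c"
    unfolding Hom_grade_apply(3)[OF c] idx(3)[symmetric]
    using c mod_homD(1)[OF D.bd_hom y]
    by (subst Hom_bd_def) (simp add: idx(1) 2 3 signed_def M.M.minus_eq M.M.l_neg M.M.r_neg)
qed

lemma Hom_dgmodule: "dgmodule R (Hom_dg R C D)"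
  using Hom_grade_module Hom_bd_hom Hom_bd_bd C.cring_axioms
  by (intro dgmodule.intro dgmodule_axioms.intro) (simp_all del: diff_diff_eq diff_diff_add)

lemma Hom_cycles_iff:
  "f \<in> carrier (cycles (Hom_dg R C D) i) \<longleftrightarrow>
    f \<in> carrier (Hom_grade R C D i) \<and> Hom_bd C D i f = \<zero>\<^bsub>Hom_grade R C D (i - 1)\<^esub>"
  by (simp add: carrier_cycles)

lemma Hom_bd_succ:
  assumes u: "u \<in> carrier (Hom_grade R C D (i + 1))" and c: "c \<in> carrier (grade C n)"
  shows "Hom_bd C D (i + 1) u n c =
    bd D (n + i + 1) (u n c) \<oplus>\<^bsub>grade D (n + i)\<^esub> signed (grade D (n + i)) i (u (n - 1) (bd C n c))"
proof -
  have idx: "n + (i + 1) - 1 = n + i" "n + (i + 1) = n + i + 1" by simp_all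
  \<comment> \<open>In degree \<open>i + 1\<close> the sign \<open>-(-1)\<^bsup>i+1\<^esup>\<close> of the second term is \<open>(-1)\<^sup>i\<close>.\<close>
  show ?thesis
    using c minus_signed_succ[OF D.grade_module mod_homD(1)[OF pre_bd_hom[OF u] c]]
    unfolding Hom_bd_def idx by simp
qed

end

locale split_dgmodule_pair = C: split_dgmodule R C h + D: split_dgmodule R D k
  for R :: "('a, 'r) ring_scheme" and C :: "('a, 'c) dgm" and h :: "int \<Rightarrow> 'c \<Rightarrow> 'c"
    and D :: "('a, 'd) dgm" and k :: "int \<Rightarrow> 'd \<Rightarrow> 'd"
begin

sublocale dgmodule_pair R C D ..

text \<open>The map \<open>u = h f e + (-1)\<^sup>i f h\<close> of degree \<open>i + 1\<close>. Composing the first term with \<open>e\<close> makes it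
  vanish on boundaries, so that it contributes nothing to \<open>u \<partial>\<close>.\<close>

definition nullhtp :: "int \<Rightarrow> (int \<Rightarrow> 'c \<Rightarrow> 'd) \<Rightarrow> int \<Rightarrow> 'c \<Rightarrow> 'd"
  where "nullhtp i f = (\<lambda>n. \<lambda>c \<in> carrier (grade C n).
    k (n + i) (f n (C.hproj n c)) \<oplus>\<^bsub>grade D (n + i + 1)\<^esub>
    signed (grade D (n + i + 1)) i (f (n + 1) (h n c)))"

lemma post_h_hom:
  assumes "f \<in> carrier (Hom_grade R C D i)"
  shows "(\<lambda>c. k (n + i) (f n (C.hproj n c))) \<in> mod_hom R (grade C n) (grade D (n + i + 1))"
  by (intro mod_hom_compose[OF mod_hom_compose[OF C.hproj_hom Hom_gradeD(1)[OF assms]] D.h_hom])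

lemma pre_h_hom:
  assumes "f \<in> carrier (Hom_grade R C D i)"
  shows "(\<lambda>c. f (n + 1) (h n c)) \<in> mod_hom R (grade C n) (grade D (n + i + 1))"
proof -
  have "n + 1 + i = n + i + 1" by simp
  then show ?thesis
    using mod_hom_compose[OF C.h_hom[of n] Hom_gradeD(1)[OF assms, of "n + 1"]] by (simp only:)
qed

lemma nullhtp_closed:
  assumes "f \<in> carrier (Hom_grade R C D i)"
  shows "nullhtp i f \<in> carrier (Hom_grade R C D (i + 1))"
proof -
  have idx: "n + (i + 1) = n + i + 1" for n by simp
  show ?thesis
    unfolding nullhtp_def
    by (rule Hom_gradeI, unfold idx)
      (intro mod_hom_add mod_hom_signed D.grade_module post_h_hom pre_h_hom assms)
qed

lemma nullhtp_hom: "nullhtp i \<in> mod_hom R (Hom_grade R C D i) (Hom_grade R C D (i + 1))"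
proof -
  interpret H: module R "Hom_grade R C D i" by (rule Hom_grade_module)
  interpret H': module R "Hom_grade R C D (i + 1)" by (rule Hom_grade_module)
  have idx: "n + (i + 1) = n + i + 1" "n + 1 + i = n + i + 1" for n by simp_all
  note ap = Hom_grade_apply
  have "nullhtp i (f \<oplus>\<^bsub>Hom_grade R C D i\<^esub> g) =
      nullhtp i f \<oplus>\<^bsub>Hom_grade R C D (i + 1)\<^esub> nullhtp i g"
    if f: "f \<in> carrier (Hom_grade R C D i)" and g: "g \<in> carrier (Hom_grade R C D i)" for f g
  proof (rule Hom_grade_eqI[OF nullhtp_closed[OF H.a_closed[OF f g]]
        H'.a_closed[OF nullhtp_closed[OF f] nullhtp_closed[OF g]]])
    fix n c assume c: "c \<in> carrier (grade C n)"
    interpret M: module R "grade D (n + i + 1)" by (rule D.grade_module)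
    note [simp] = mod_homD(1)[OF post_h_hom c] mod_homD(1)[OF pre_h_hom c]
    have hc: "h n c \<in> carrier (grade C (n + 1))" using mod_homD(1)[OF C.h_hom c] .
    have pc: "C.hproj n c \<in> carrier (grade C n)" using C.hproj_closed[OF c] .
    show "nullhtp i (f \<oplus>\<^bsub>Hom_grade R C D i\<^esub> g) n c =
        (nullhtp i f \<oplus>\<^bsub>Hom_grade R C D (i + 1)\<^esub> nullhtp i g) n c"
      using f g c hc pc Hom_grade_closed[OF f pc] Hom_grade_closed[OF g pc]
      by (simp add: ap idx nullhtp_def signed_def M.M.minus_add M.M.a_ac mod_homD(2)[OF D.h_hom])
  qed
  moreover have "nullhtp i (a \<odot>\<^bsub>Hom_grade R C D i\<^esub> f) =
      a \<odot>\<^bsub>Hom_grade R C D (i + 1)\<^esub> nullhtp i f"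
    if a: "a \<in> carrier R" and f: "f \<in> carrier (Hom_grade R C D i)" for a f
  proof (rule Hom_grade_eqI[OF nullhtp_closed[OF H.smult_closed[OF a f]]
        H'.smult_closed[OF a nullhtp_closed[OF f]]])
    fix n c assume c: "c \<in> carrier (grade C n)"
    interpret M: module R "grade D (n + i + 1)" by (rule D.grade_module)
    note [simp] = mod_homD(1)[OF post_h_hom c] mod_homD(1)[OF pre_h_hom c]
    have hc: "h n c \<in> carrier (grade C (n + 1))" using mod_homD(1)[OF C.h_hom c] .
    have pc: "C.hproj n c \<in> carrier (grade C n)" using C.hproj_closed[OF c] .
    show "nullhtp i (a \<odot>\<^bsub>Hom_grade R C D i\<^esub> f) n c =
        (a \<odot>\<^bsub>Hom_grade R C D (i + 1)\<^esub> nullhtp i f) n c"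
      using f a c hc pc Hom_grade_closed[OF f pc]
      by (simp add: ap idx nullhtp_def signed_def M.smult_r_distr M.smult_r_minus
          mod_homD(3)[OF D.h_hom])
  qed
  ultimately show ?thesis
    using nullhtp_closed by (auto simp: mod_hom_def)
qed

text \<open>At \<open>c\<close>, the cycle condition gives \<open>\<partial> (-1)\<^sup>i f h c = f \<partial> h c\<close>, the condition on cycles
  gives \<open>\<partial> h f e c = f e c\<close>, and \<open>e \<partial> c = 0\<close> leaves \<open>(-1)\<^sup>i u \<partial> c = f h \<partial> c\<close>. The three
  values add up to \<open>f c\<close> by the definition of \<open>e\<close>.\<close>

lemma bd_nullhtp:
  assumes f: "f \<in> carrier (cycles (Hom_dg R C D) i)"
    and null: "\<And>n z. z \<in> carrier (cycles C n) \<Longrightarrow> f n z \<in> carrier (boundaries D (n + i))"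
  shows "Hom_bd C D (i + 1) (nullhtp i f) = f"
proof -
  have fH: "f \<in> carrier (Hom_grade R C D i)" using f by (simp add: Hom_cycles_iff)
  note u = nullhtp_closed[OF fH]
  have "Hom_bd C D (i + 1) (nullhtp i f) \<in> carrier (Hom_grade R C D i)"
    using Hom_bd_closed[OF u] by simp
  then show ?thesis
  proof (rule Hom_grade_eqI[OF _ fH])
    fix n c assume c: "c \<in> carrier (grade C n)"
    interpret M: module R "grade D (n + i)" by (rule D.grade_module)
    interpret N: module R "grade C n" by (rule C.grade_module)
    note f_hom = Hom_gradeD(1)[OF fH]
    have mD: "module R (grade D m)" for m by (rule D.grade_module)
    let ?e = "C.hproj n c" and ?x = "bd C (n + 1) (h n c)" and ?y = "h (n - 1) (bd C n c)"
    have e: "?e \<in> carrier (grade C n)" using C.hproj_closed[OF c] .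
    have x: "?x \<in> carrier (grade C n)" using mod_homD(1)[OF C.bd_h_hom c] .
    have y: "?y \<in> carrier (grade C n)" using mod_homD(1)[OF C.h_bd_hom c] .
    have fe: "f n ?e \<in> carrier (grade D (n + i))" and fx: "f n ?x \<in> carrier (grade D (n + i))"
      and fy: "f n ?y \<in> carrier (grade D (n + i))"
      using Hom_grade_closed[OF fH] e x y by blast+
    have bd_hom': "bd D (n + i + 1) \<in> mod_hom R (grade D (n + i + 1)) (grade D (n + i))"
      using D.bd_hom[of "n + i + 1"] by simp
    define w where "w = f (n + 1) (h n c)"
    have hc: "h n c \<in> carrier (grade C (n + 1))" using mod_homD(1)[OF C.h_hom c] .
    have w: "w \<in> carrier (grade D (n + i + 1))"
      using mod_homD(1)[OF pre_h_hom[OF fH] c] by (simp add: w_def)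
    have idx: "n + 1 + i = n + i + 1" "n - 1 + i = n + i - 1" by simp_all
    have "bd D (n + i + 1) w = signed (grade D (n + i)) i (f n ?x)"
      using Hom_cycle_commutes[OF C.dgmodule_axioms D.dgmodule_axioms f hc] by (simp add: idx w_def)
    then have bd_w: "bd D (n + i + 1) (signed (grade D (n + i + 1)) i w) = f n ?x"
      using mod_hom_signed_commute[OF mD mD bd_hom' w] signed_signed[OF mD fx] by simp
    have bd_k: "bd D (n + i + 1) (k (n + i) (f n ?e)) = f n ?e"
      using D.bd_h_boundary[OF null[OF C.hproj_cycle[OF c]]] .
    have "bd D (n + i + 1) (nullhtp i f n c) = f n ?e \<oplus>\<^bsub>grade D (n + i)\<^esub> f n ?x"
      using c bd_w bd_k mod_homD(2)[OF bd_hom' mod_homD(1)[OF D.h_hom fe] signed_closed[OF mD w]]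
      by (simp add: nullhtp_def w_def)
    moreover have "nullhtp i f (n - 1) (bd C n c) = signed (grade D (n + i)) i (f n ?y)"
    proof -
      have bc: "bd C n c \<in> carrier (grade C (n - 1))" using mod_homD(1)[OF C.bd_hom c] .
      have "C.hproj (n - 1) (bd C n c) = \<zero>\<^bsub>grade C (n - 1)\<^esub>"
        using c by (intro C.hproj_boundary) (simp add: carrier_boundaries)
      then have "k (n - 1 + i) (f (n - 1) (C.hproj (n - 1) (bd C n c))) = \<zero>\<^bsub>grade D (n - 1 + i + 1)\<^esub>"
        using mod_hom_zero[OF C.grade_module mD mod_hom_compose[OF f_hom D.h_hom], of "n - 1"] by simp
      then show ?thesis
        using bc signed_closed[OF mD fy] by (simp add: nullhtp_def idx)
    qed
    ultimately have "Hom_bd C D (i + 1) (nullhtp i f) n c =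
        (f n ?e \<oplus>\<^bsub>grade D (n + i)\<^esub> f n ?x) \<oplus>\<^bsub>grade D (n + i)\<^esub> f n ?y"
      using Hom_bd_succ[OF u c] signed_signed[OF mD fy] by simp
    also have "\<dots> = f n (?e \<oplus>\<^bsub>grade C n\<^esub> (?x \<oplus>\<^bsub>grade C n\<^esub> ?y))"
      using e x y fe fx fy by (simp add: mod_homD(2)[OF f_hom] M.M.a_assoc)
    also have "\<dots> = f n c"
      using C.hproj_decomp[OF c] by simp
    finally show "Hom_bd C D (i + 1) (nullhtp i f) n c = f n c" .
  qed
qed

text \<open>By \<open>bd_nullhtp\<close>, \<open>nullhtp\<close> inverts the differential on all cycles of \<open>Hom(C, D)\<close> that map
  cycles to boundaries. Boundaries of \<open>Hom(C, D)\<close> are of this kind.\<close>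

lemma Hom_split: "split_dgmodule R (Hom_dg R C D) nullhtp"
proof (intro split_dgmodule.intro split_dgmodule_axioms.intro Hom_dgmodule)
  interpret H: dgmodule R "Hom_dg R C D" by (rule Hom_dgmodule)
  show "nullhtp i \<in> mod_hom R (grade (Hom_dg R C D) i) (grade (Hom_dg R C D) (i + 1))" for i
    using nullhtp_hom by simp
  fix f i assume "f \<in> carrier (grade (Hom_dg R C D) i)"
  then have f: "f \<in> carrier (Hom_grade R C D i)" by simp
  have "Hom_bd C D (i - 1 + 1) (nullhtp (i - 1) (Hom_bd C D i f)) = Hom_bd C D i f"
  proof (rule bd_nullhtp)
    show "Hom_bd C D i f \<in> carrier (cycles (Hom_dg R C D) (i - 1))"
      using Hom_bd_closed[OF f] Hom_bd_bd[OF f] by (simp only: Hom_cycles_iff)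
    fix n z assume z: "z \<in> carrier (cycles C n)"
    then have "f n z \<in> carrier (grade D (n + i))"
      using Hom_grade_closed[OF f] by (simp add: carrier_cycles)
    moreover have "n + (i - 1) + 1 = n + i" by simp
    ultimately show "Hom_bd C D i f n z \<in> carrier (boundaries D (n + (i - 1)))"
      unfolding carrier_boundaries Hom_bd_on_cycle[OF f z] by (simp only:) blast
  qed
  then show "bd (Hom_dg R C D) i (nullhtp (i - 1) (bd (Hom_dg R C D) i f)) = bd (Hom_dg R C D) i f"
    by simp
qed

end

section \<open>Homology of the dgmodule of homomorphisms\<close>

context dgmodule_pair
begin

abbreviation Hom_of_homology :: "int \<Rightarrow> ('a, int \<Rightarrow> 'c set \<Rightarrow> 'd set) module"
  where "Hom_of_homology \<equiv> Hom_grade R (zero_bd (homology C)) (zero_bd (homology D))"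

lemma Hom_of_homology_iff:
  "g \<in> carrier (Hom_of_homology i) \<longleftrightarrow>
    (\<forall>n. g n \<in> mod_hom R (homology C n) (homology D (n + i)) \<inter> extensional (carrier (homology C n)))"
  by (simp add: Hom_grade_def zero_bd_def)

lemma Hom_of_homology_module: "module R (Hom_of_homology i)"
proof -
  interpret H: dgmodule_pair R "zero_bd (homology C)" "zero_bd (homology D)"
    by (intro dgmodule_pair.intro C.zero_bd_homology_dgmodule D.zero_bd_homology_dgmodule)
  show ?thesis by (rule H.Hom_grade_module)
qed

lemma Hom_of_homology_apply:
  assumes "X \<in> carrier (homology C n)"
  shows "(f \<oplus>\<^bsub>Hom_of_homology i\<^esub> g) n X = f n X \<oplus>\<^bsub>homology D (n + i)\<^esub> g n X"
    and "(a \<odot>\<^bsub>Hom_of_homology i\<^esub> f) n X = a \<odot>\<^bsub>homology D (n + i)\<^esub> f n X"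
    and "\<zero>\<^bsub>Hom_of_homology i\<^esub> n X = \<zero>\<^bsub>homology D (n + i)\<^esub>"
  using assms by (simp_all add: Hom_grade_def zero_bd_def)

lemma Hom_of_homology_eqI:
  assumes "f \<in> carrier (Hom_of_homology i)" "g \<in> carrier (Hom_of_homology i)"
    and "\<And>n z. z \<in> carrier (cycles C n) \<Longrightarrow> f n (hclass C n z) = g n (hclass C n z)"
  shows "f = g"
  using assms(3) by (intro Hom_grade_eqI[OF assms(1,2)]) (auto simp: zero_bd_def carrier_homology)

lemma Hom_cycle_preserves_cycles:
  assumes f: "f \<in> carrier (cycles (Hom_dg R C D) i)" and z: "z \<in> carrier (cycles C n)"
  shows "f n z \<in> carrier (cycles D (n + i))"
proof -
  have fH: "f \<in> carrier (Hom_grade R C D i)" and f0: "Hom_bd C D i f = \<zero>\<^bsub>Hom_grade R C D (i - 1)\<^esub>"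
    using f by (simp_all add: Hom_cycles_iff)
  have zc: "z \<in> carrier (grade C n)" using z by (simp add: carrier_cycles)
  have idx: "n + (i - 1) = n + i - 1" by simp
  have "bd D (n + i) (f n z) = \<zero>\<^bsub>grade D (n + (i - 1))\<^esub>"
    using Hom_bd_on_cycle[OF fH z] by (simp only: f0 Hom_grade_apply(3)[OF zc])
  then show ?thesis
    using Hom_grade_closed[OF fH zc] by (simp add: carrier_cycles idx)
qed

lemmas induced_apply = induced_hclass[OF C.dgmodule_axioms D.dgmodule_axioms]

lemma induced_hom: "induced C D i \<in> mod_hom R (cycles (Hom_dg R C D) i) (Hom_of_homology i)"
proof -
  interpret H: dgmodule R "Hom_dg R C D" by (rule Hom_dgmodule)
  interpret Z: module R "cycles (Hom_dg R C D) i" by (rule H.cycles_module)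
  interpret Hom_of_homology: module R "Hom_of_homology i" by (rule Hom_of_homology_module)
  let ?Z = "carrier (cycles (Hom_dg R C D) i)"
  have closed: "induced C D i f \<in> carrier (Hom_of_homology i)" if f: "f \<in> ?Z" for f
  proof -
    have fH: "f \<in> carrier (Hom_grade R C D i)" using f by (simp add: Hom_cycles_iff)
    have "induced C D i f n \<in> mod_hom R (homology C n) (homology D (n + i))" for n
    proof (rule C.mod_hom_from_homology)
      have "f n \<in> mod_hom R (cycles C n) (cycles D (n + i))"
        using Hom_cycle_preserves_cycles[OF f] Hom_gradeD(1)[OF fH, of n]
        by (auto simp: mod_hom_def carrier_cycles[of _ C])
      then show "(\<lambda>z. hclass D (n + i) (f n z)) \<in> mod_hom R (cycles C n) (homology D (n + i))"
        by (rule mod_hom_compose[OF _ D.hclass_hom])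
    qed (rule induced_apply[OF f])
    then show ?thesis by (simp add: Hom_of_homology_iff) (simp add: induced_def)
  qed
  have cyc: "f n z \<in> carrier (cycles D (n + i))" "z \<in> carrier (grade C n)"
    "hclass C n z \<in> carrier (homology C n)"
    if "f \<in> ?Z" "z \<in> carrier (cycles C n)" for f n z
    using that Hom_cycle_preserves_cycles by (auto simp: carrier_cycles[of _ C] carrier_homology)
  have "induced C D i (f \<oplus>\<^bsub>cycles (Hom_dg R C D) i\<^esub> g) = induced C D i f \<oplus>\<^bsub>Hom_of_homology i\<^esub> induced C D i g"
    if f: "f \<in> ?Z" and g: "g \<in> ?Z" for f g
  proof (rule Hom_of_homology_eqI[OF closed[OF Z.a_closed[OF f g]] Hom_of_homology.a_closed[OF closed[OF f] closed[OF g]]])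
    fix n z assume z: "z \<in> carrier (cycles C n)"
    show "induced C D i (f \<oplus>\<^bsub>cycles (Hom_dg R C D) i\<^esub> g) n (hclass C n z) =
        (induced C D i f \<oplus>\<^bsub>Hom_of_homology i\<^esub> induced C D i g) n (hclass C n z)"
      using mod_homD(2)[OF D.hclass_hom cyc(1)[OF f z] cyc(1)[OF g z]] cyc(2,3)[OF f z]
      by (simp only: Hom_of_homology_apply induced_apply f g z Z.a_closed cycles_simps Hom_dg_simps Hom_grade_apply
          induced_apply[OF Z.a_closed[OF f g] z, unfolded cycles_simps Hom_dg_simps])
  qed
  moreover have "induced C D i (a \<odot>\<^bsub>cycles (Hom_dg R C D) i\<^esub> f) = a \<odot>\<^bsub>Hom_of_homology i\<^esub> induced C D i f"
    if a: "a \<in> carrier R" and f: "f \<in> ?Z" for a f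
  proof (rule Hom_of_homology_eqI[OF closed[OF Z.smult_closed[OF a f]] Hom_of_homology.smult_closed[OF a closed[OF f]]])
    fix n z assume z: "z \<in> carrier (cycles C n)"
    show "induced C D i (a \<odot>\<^bsub>cycles (Hom_dg R C D) i\<^esub> f) n (hclass C n z) =
        (a \<odot>\<^bsub>Hom_of_homology i\<^esub> induced C D i f) n (hclass C n z)"
      using mod_homD(3)[OF D.hclass_hom a cyc(1)[OF f z]] cyc(2,3)[OF f z]
      by (simp only: Hom_of_homology_apply induced_apply f z cycles_simps Hom_dg_simps Hom_grade_apply
          induced_apply[OF Z.smult_closed[OF a f] z, unfolded cycles_simps Hom_dg_simps])
  qed
  ultimately show ?thesis
    using closed by (auto simp: mod_hom_def)
qed

text \<open>This puts the hypothesis of part b) in the form that \<open>bd_nullhtp\<close> requires.\<close>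

lemma induced_eq_zero_iff:
  assumes f: "f \<in> carrier (cycles (Hom_dg R C D) i)"
  shows "induced C D i f = \<zero>\<^bsub>Hom_of_homology i\<^esub> \<longleftrightarrow>
    (\<forall>n. \<forall>z \<in> carrier (cycles C n). f n z \<in> carrier (boundaries D (n + i)))"
proof -
  interpret Hom_of_homology: module R "Hom_of_homology i" by (rule Hom_of_homology_module)
  have "induced C D i f = \<zero>\<^bsub>Hom_of_homology i\<^esub> \<longleftrightarrow>
      (\<forall>n. \<forall>z \<in> carrier (cycles C n). hclass D (n + i) (f n z) = \<zero>\<^bsub>homology D (n + i)\<^esub>)"
  proof
    assume *: "induced C D i f = \<zero>\<^bsub>Hom_of_homology i\<^esub>"
    show "\<forall>n. \<forall>z \<in> carrier (cycles C n). hclass D (n + i) (f n z) = \<zero>\<^bsub>homology D (n + i)\<^esub>"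
      using induced_apply[OF f, symmetric] by (simp add: * Hom_of_homology_apply(3) carrier_homology)
  next
    assume "\<forall>n. \<forall>z \<in> carrier (cycles C n). hclass D (n + i) (f n z) = \<zero>\<^bsub>homology D (n + i)\<^esub>"
    then show "induced C D i f = \<zero>\<^bsub>Hom_of_homology i\<^esub>"
      by (intro Hom_of_homology_eqI[OF mod_homD(1)[OF induced_hom f] Hom_of_homology.zero_closed])
        (simp add: induced_apply[OF f] Hom_of_homology_apply(3) carrier_homology)
  qed
  also have "\<dots> \<longleftrightarrow> (\<forall>n. \<forall>z \<in> carrier (cycles C n). f n z \<in> carrier (boundaries D (n + i)))"
    using D.hclass_eq_zero_iff Hom_cycle_preserves_cycles[OF f] by (simp add: carrier_cycles[of _ D])
  finally show ?thesis .
qed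

lemma hom_homology_apply:
  "f \<in> carrier (cycles (Hom_dg R C D) i) \<Longrightarrow>
    hom_homology C D i (hclass (Hom_dg R C D) i f) = induced C D i f"
  by (rule hom_homology_hclass[OF C.dgmodule_axioms D.dgmodule_axioms])

lemma hom_homology_hom: "hom_homology C D i \<in> mod_hom R (homology (Hom_dg R C D) i) (Hom_of_homology i)"
proof -
  interpret H: dgmodule R "Hom_dg R C D" by (rule Hom_dgmodule)
  show ?thesis
    using induced_hom hom_homology_apply by (rule H.mod_hom_from_homology)
qed

end

context split_dgmodule_pair
begin

text \<open>The preimage is \<open>f c = lift (g [e c])\<close>. Both terms of its differential vanish: \<open>lift\<close> has
  cycles as values, and \<open>e\<close> kills boundaries. It induces \<open>g\<close> because \<open>[e z] = [z]\<close> and \<open>lift\<close> is a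
  section.\<close>

lemma induced_surj:
  assumes g: "g \<in> carrier (Hom_of_homology i)"
  obtains f where "f \<in> carrier (cycles (Hom_dg R C D) i)" "induced C D i f = g"
proof -
  have g_hom: "g n \<in> mod_hom R (homology C n) (homology D (n + i))" for n
    using g by (simp add: Hom_of_homology_iff)
  have proj_hom: "C.hproj n \<in> mod_hom R (grade C n) (cycles C n)" for n
    using C.hproj_hom[of n] C.hproj_cycle by (auto simp: mod_hom_def)
  define f where "f n = (\<lambda>c \<in> carrier (grade C n).
    D.lift (n + i) (g n (hclass C n (C.hproj n c))))" for n
  have lift_g_hom: "(\<lambda>c. D.lift (n + i) (g n (hclass C n (C.hproj n c))))
      \<in> mod_hom R (grade C n) (cycles D (n + i))" for n
    by (intro mod_hom_compose[OF mod_hom_compose[OF mod_hom_compose[OF proj_hom C.hclass_hom] g_hom]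
          D.lift_hom])
  have cyc: "f n c \<in> carrier (cycles D (n + i))" if "c \<in> carrier (grade C n)" for n c
    using mod_homD(1)[OF lift_g_hom that] that by (simp add: f_def)
  have fH: "f \<in> carrier (Hom_grade R C D i)"
  proof -
    have "(\<lambda>c. D.lift (n + i) (g n (hclass C n (C.hproj n c)))) \<in> mod_hom R (grade C n) (grade D (n + i))" for n
      using lift_g_hom[of n] by (auto simp: mod_hom_def carrier_cycles[of _ D])
    from Hom_gradeI[OF this] show ?thesis unfolding f_def .
  qed
  interpret H': module R "Hom_grade R C D (i - 1)" by (rule Hom_grade_module)
  have "Hom_bd C D i f = \<zero>\<^bsub>Hom_grade R C D (i - 1)\<^esub>"
  proof (rule Hom_grade_eqI[OF Hom_bd_closed[OF fH] H'.zero_closed])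
    fix n c assume c: "c \<in> carrier (grade C n)"
    interpret M: module R "grade D (n + i - 1)" by (rule D.grade_module)
    have idx: "n + (i - 1) = n + i - 1" "n - 1 + i = n + i - 1" by simp_all
    have bc: "bd C n c \<in> carrier (grade C (n - 1))" using mod_homD(1)[OF C.bd_hom c] .
    have "C.hproj (n - 1) (bd C n c) = \<zero>\<^bsub>grade C (n - 1)\<^esub>"
      using c by (intro C.hproj_boundary) (simp add: carrier_boundaries)
    moreover have "C.hproj (n - 1) \<zero>\<^bsub>grade C (n - 1)\<^esub> = \<zero>\<^bsub>grade C (n - 1)\<^esub>"
      using mod_hom_zero[OF C.grade_module C.grade_module C.hproj_hom] .
    moreover have "D.lift (n - 1 + i) (g (n - 1) (hclass C (n - 1) (C.hproj (n - 1) \<zero>\<^bsub>grade C (n - 1)\<^esub>)))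
        = \<zero>\<^bsub>grade D (n - 1 + i)\<^esub>"
      using mod_hom_zero[OF C.grade_module D.cycles_module lift_g_hom] by simp
    ultimately have "f (n - 1) (bd C n c) = \<zero>\<^bsub>grade D (n + i - 1)\<^esub>"
      using bc by (simp add: f_def idx)
    moreover have "bd D (n + i) (f n c) = \<zero>\<^bsub>grade D (n + i - 1)\<^esub>"
      using cyc[OF c] by (simp add: carrier_cycles)
    ultimately show "Hom_bd C D i f n c = \<zero>\<^bsub>Hom_grade R C D (i - 1)\<^esub> n c"
      using c by (simp add: Hom_bd_def Hom_grade_apply(3) idx signed_def M.M.minus_eq)
  qed
  with fH have f: "f \<in> carrier (cycles (Hom_dg R C D) i)" by (simp add: Hom_cycles_iff)
  moreover have "induced C D i f = g"
  proof (rule Hom_of_homology_eqI[OF mod_homD(1)[OF induced_hom f] g])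
    fix n z assume z: "z \<in> carrier (cycles C n)"
    then have "z \<in> carrier (grade C n)" and "hclass C n z \<in> carrier (homology C n)"
      by (simp_all add: carrier_cycles carrier_homology)
    then show "induced C D i f n (hclass C n z) = g n (hclass C n z)"
      using mod_homD(1)[OF g_hom]
      by (simp add: induced_apply[OF f z] f_def C.hclass_hproj[OF z] D.hclass_lift)
  qed
  ultimately show ?thesis by (rule that)
qed

lemma induced_zero_imp_boundary:
  assumes f: "f \<in> carrier (cycles (Hom_dg R C D) i)" and "induced C D i f = \<zero>\<^bsub>Hom_of_homology i\<^esub>"
  shows "Hom_bd C D (i + 1) (nullhtp i f) = f"
  using assms by (intro bd_nullhtp[OF f]) (simp add: induced_eq_zero_iff)

lemma hom_homology_iso: "hom_homology C D i \<in> mod_iso R (homology (Hom_dg R C D) i) (Hom_of_homology i)"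
proof -
  interpret H: dgmodule R "Hom_dg R C D" by (rule Hom_dgmodule)
  have "inj_on (hom_homology C D i) (carrier (homology (Hom_dg R C D) i))"
  proof (rule mod_hom_inj[OF H.homology_module Hom_of_homology_module hom_homology_hom])
    fix F assume "F \<in> carrier (homology (Hom_dg R C D) i)" and F0: "hom_homology C D i F = \<zero>\<^bsub>Hom_of_homology i\<^esub>"
    then obtain f where f: "f \<in> carrier (cycles (Hom_dg R C D) i)" "F = hclass (Hom_dg R C D) i f"
      by (auto simp: carrier_homology)
    have fH: "f \<in> carrier (Hom_grade R C D i)" using f(1) by (simp add: Hom_cycles_iff)
    have "Hom_bd C D (i + 1) (nullhtp i f) = f"
      using F0 f by (intro induced_zero_imp_boundary) (simp_all add: hom_homology_apply)
    then have "f \<in> carrier (boundaries (Hom_dg R C D) i)"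
      using nullhtp_closed[OF fH] by (auto simp: carrier_boundaries image_iff intro: sym)
    then show "F = \<zero>\<^bsub>homology (Hom_dg R C D) i\<^esub>"
      using H.hclass_eq_zero_iff[of f i] fH f(2) by simp
  qed
  moreover have "hom_homology C D i ` carrier (homology (Hom_dg R C D) i) = carrier (Hom_of_homology i)"
  proof
    show "hom_homology C D i ` carrier (homology (Hom_dg R C D) i) \<subseteq> carrier (Hom_of_homology i)"
      using mod_homD(1)[OF hom_homology_hom] by blast
    show "carrier (Hom_of_homology i) \<subseteq> hom_homology C D i ` carrier (homology (Hom_dg R C D) i)"
    proof
      fix g assume "g \<in> carrier (Hom_of_homology i)"
      then obtain f where "f \<in> carrier (cycles (Hom_dg R C D) i)" "induced C D i f = g"
        by (rule induced_surj)
      then show "g \<in> hom_homology C D i ` carrier (homology (Hom_dg R C D) i)"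
        using hom_homology_apply by (force simp: carrier_homology)
    qed
  qed
  ultimately show ?thesis
    using hom_homology_hom by (simp add: mod_iso_def bij_betw_def)
qed

end

theorem proposition2p3:
  fixes R :: "('a, 'r) ring_scheme" and C :: "('a, 'c) dgm" and D :: "('a, 'd) dgm"
  assumes "cring R"
    and "dgmodule R C" and "assumption_A R C"
    and "dgmodule R D" and "assumption_A R D"
  shows
    "(\<forall>i. \<forall>g \<in> carrier (grade (Hom_dg R (zero_bd (homology C)) (zero_bd (homology D))) i).
        \<exists>f \<in> carrier (grade (Hom_dg R C D) i).
          bd (Hom_dg R C D) i f = \<zero>\<^bsub>grade (Hom_dg R C D) (i - 1)\<^esub> \<and> induced C D i f = g) \<and>
     (\<forall>i. \<forall>f \<in> carrier (grade (Hom_dg R C D) i).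
        bd (Hom_dg R C D) i f = \<zero>\<^bsub>grade (Hom_dg R C D) (i - 1)\<^esub> \<and>
        induced C D i f = \<zero>\<^bsub>grade (Hom_dg R (zero_bd (homology C)) (zero_bd (homology D))) i\<^esub> \<longrightarrow>
        (\<exists>u \<in> carrier (grade (Hom_dg R C D) (i + 1)). bd (Hom_dg R C D) (i + 1) u = f)) \<and>
     (\<forall>i. hom_homology C D i \<in>
        mod_iso R (homology (Hom_dg R C D) i)
          (grade (Hom_dg R (zero_bd (homology C)) (zero_bd (homology D))) i)) \<and>
     dgmodule R (Hom_dg R C D) \<and> assumption_A R (Hom_dg R C D)"
proof -
  obtain h where "split_dgmodule R C h"
    using assms(2,3) by (rule assumption_A_obtains_split)
  moreover obtain k where "split_dgmodule R D k"
    using assms(4,5) by (rule assumption_A_obtains_split)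
  ultimately interpret split_dgmodule_pair R C h D k
    by (rule split_dgmodule_pair.intro)
  interpret H: split_dgmodule R "Hom_dg R C D" nullhtp by (rule Hom_split)
  have "\<exists>f \<in> carrier (Hom_grade R C D i).
      Hom_bd C D i f = \<zero>\<^bsub>Hom_grade R C D (i - 1)\<^esub> \<and> induced C D i f = g"
    if "g \<in> carrier (Hom_of_homology i)" for i g
    using induced_surj[OF that] by (auto simp: Hom_cycles_iff)
  moreover have "\<exists>u \<in> carrier (Hom_grade R C D (i + 1)). Hom_bd C D (i + 1) u = f"
    if "f \<in> carrier (Hom_grade R C D i)"
      and "Hom_bd C D i f = \<zero>\<^bsub>Hom_grade R C D (i - 1)\<^esub>" "induced C D i f = \<zero>\<^bsub>Hom_of_homology i\<^esub>" for i f
    using that induced_zero_imp_boundary[of f i] nullhtp_closed by (auto simp: Hom_cycles_iff)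
  ultimately show ?thesis
    using hom_homology_iso Hom_dgmodule H.split_imp_assumption_A by simp
qed

end
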